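(* Let $d$ be an integer greater than $5$ and let $\pi$ be a convex polygon with $2d+2$ vertices. There exists a pair of centrally symmetric triangulations of $\pi$ whose distance (minimal number of flips transforming one into the other) is at least $5d/2-4\sqrt{d}-4$.
   Context: Let $\pi$ be a convex polygon with $2d+2$ vertices. An edge on $\pi$ is a set of two distinct vertices of $\pi$. For a vertex $x$ of $\pi$, $\bar{x}$ denotes the opposite vertex, i.e. the one separated from $x$ by exactly $d$ vertices along the boundary on either side. A triangulation of $\pi$ is a maximal set of pairwise non-crossing edges on $\pi$; it contains all boundary edges of $\pi$, and its other edges are called interior edges. A triangulation $T$ is centrally symmetric when $\{x,y\}\in T$ implies $\{\bar{x},\bar{y}\}\in T$. Flip: let $T$ be a centrally symmetric triangulation and $\{x,x'\}$ an interior edge of $T$. There is a unique quadrilateral whose four boundary edges belong to $T$ and which has $\{x,x'\}$ as one of its two diagonals; let $y,y'$ be its other two vertices. Flipping $\{x,x'\}$ in $T$ means replacing $\{x,x'\}$ and $\{\bar{x},\bar{x}'\}$ by $\{y,y'\}$ and $\{\bar{y},\bar{y}'\}$. (When $x'=\bar{x}$, one has $y'=\bar{y}$ and just one edge is replaced.) The result is again a centrally symmetric triangulation. The distance of two centrally symmetric triangulations is the minimal number of flips needed to transform one into the other. *)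

theory Defs
  imports "HOL-Analysis.Analysis"
begin

text \<open>
  A convex polygon with \<open>n\<close> vertices is given by the positions \<open>p 0, \<dots>, p (n - 1)\<close> of its
  vertices in the plane, enumerated counterclockwise along the boundary. A vertex is referred to
  by its index \<open>i < n\<close>, so that edges are two-element sets of indices.
\<close>

definition left_of :: "complex \<Rightarrow> complex \<Rightarrow> complex \<Rightarrow> bool" where
  "left_of a b c \<longleftrightarrow> Re (b - a) * Im (c - a) - Im (b - a) * Re (c - a) > 0"

text \<open>
  Every vertex lies strictly to the left of each directed side it is not an endpoint of. This
  forces the vertices to be distinct and in strictly convex position.
\<close>

definition convex_polygon :: "nat \<Rightarrow> (nat \<Rightarrow> complex) \<Rightarrow> bool" where
  "convex_polygon n p \<longleftrightarrow> 3 \<le> n \<and>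
     (\<forall>i<n. \<forall>j<n. j \<noteq> i \<longrightarrow> j \<noteq> Suc i mod n \<longrightarrow> left_of (p i) (p (Suc i mod n)) (p j))"

definition edges :: "nat \<Rightarrow> nat set set" where
  "edges n = {{x, y} | x y. x < n \<and> y < n \<and> x \<noteq> y}"

definition boundary_edges :: "nat \<Rightarrow> nat set set" where
  "boundary_edges n = {{i, Suc i mod n} | i. i < n}"

definition crossing :: "(nat \<Rightarrow> complex) \<Rightarrow> nat set \<Rightarrow> nat set \<Rightarrow> bool" where
  "crossing p e f \<longleftrightarrow> e \<noteq> f \<and>
     (\<exists>x y u v. e = {x, y} \<and> f = {u, v} \<and>
        open_segment (p x) (p y) \<inter> open_segment (p u) (p v) \<noteq> {})"

definition noncrossing_edges :: "nat \<Rightarrow> (nat \<Rightarrow> complex) \<Rightarrow> nat set set \<Rightarrow> bool" where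
  "noncrossing_edges n p T \<longleftrightarrow> T \<subseteq> edges n \<and> (\<forall>e\<in>T. \<forall>f\<in>T. \<not> crossing p e f)"

definition triangulation :: "nat \<Rightarrow> (nat \<Rightarrow> complex) \<Rightarrow> nat set set \<Rightarrow> bool" where
  "triangulation n p T \<longleftrightarrow> noncrossing_edges n p T \<and>
     (\<forall>T'. noncrossing_edges n p T' \<longrightarrow> T \<subseteq> T' \<longrightarrow> T' = T)"

definition opposite :: "nat \<Rightarrow> nat \<Rightarrow> nat" where
  "opposite d x = (x + (d + 1)) mod (2 * d + 2)"

definition cs_triangulation :: "nat \<Rightarrow> (nat \<Rightarrow> complex) \<Rightarrow> nat set set \<Rightarrow> bool" where
  "cs_triangulation d p T \<longleftrightarrow> triangulation (2 * d + 2) p T \<and>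
     (\<forall>x y. {x, y} \<in> T \<longrightarrow> {opposite d x, opposite d y} \<in> T)"

text \<open>
  The crossing condition says that \<open>{x, x'}\<close> and \<open>{y, y'}\<close> are the two diagonals of the
  quadrilateral with sides \<open>{x, y}\<close>, \<open>{y, x'}\<close>, \<open>{x', y'}\<close>, \<open>{y', x}\<close>.
\<close>

definition flip :: "nat \<Rightarrow> (nat \<Rightarrow> complex) \<Rightarrow> nat set set \<Rightarrow> nat set set \<Rightarrow> bool" where
  "flip d p T T' \<longleftrightarrow> cs_triangulation d p T \<and>
     (\<exists>x x' y y'. {x, x'} \<in> T - boundary_edges (2 * d + 2) \<and>
        {{x, y}, {y, x'}, {x', y'}, {y', x}} \<subseteq> T \<and>
        crossing p {x, x'} {y, y'} \<and>
        T' = (T - {{x, x'}, {opposite d x, opposite d x'}})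
               \<union> {{y, y'}, {opposite d y, opposite d y'}})"

text \<open>Graph distance in the flip graph, with value \<open>\<infinity>\<close> if there is no sequence of flips.\<close>

definition flip_distance :: "nat \<Rightarrow> (nat \<Rightarrow> complex) \<Rightarrow> nat set set \<Rightarrow> nat set set \<Rightarrow> enat" where
  "flip_distance d p T T' = (INF k \<in> {k. (flip d p ^^ k) T T'}. enat k)"

end

theory Submission
  imports Defs
begin

text \<open>
  Put \<open>n = d + 1\<close> and unroll the polygon: its vertices are the integers modulo \<open>2 * n\<close>, and the vertex
  opposite to \<open>x\<close> is \<open>x + n\<close>. Give every triangle \<open>(a, b, c)\<close> with \<open>a < b < c \<le> a + n\<close> a weight that is
  invariant under translation by \<open>n\<close>, and let the potential of a centrally symmetric triangulation
  be the sum of the weights of its triangles modulo central symmetry. A flip exchanges two triangles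
  \<open>abc\<close>, \<open>ace\<close> for \<open>abe\<close>, \<open>bce\<close> (or, at a diameter, one triangle for another), hence the number of
  flips between two triangulations is at least their potential difference divided by the largest
  change of the weight under such an exchange. The weights below change by at most \<open>2 * N\<close>, where
  \<open>N\<close> is close to \<open>sqrt d\<close>, while the potentials of two suitable zigzag triangulations differ by
  about \<open>10 * N - 4\<close> for each of about \<open>d / 2\<close> steps of the zigzag.
\<close>

section \<open>Crossing diagonals of a convex polygon\<close>

text \<open>A zigzag step has weights close to \<open>- 2 * N\<close> and \<open>- 2 * N\<close> in
  the first triangulation and to \<open>2 * N\<close> and \<open>4 * N\<close> in the second. The
  gap of about \<open>10 * N\<close>, at \<open>2 * N\<close> per flip, is the five flips per step.
  The obstacle is that weights may not jump: sliding an edge by one unit is itself a flip. Hence the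
  ramp \<open>R\<close> climbs from 0 to \<open>2 * N\<close> with slope 2, over
  \<open>N = 2 * s - 1\<close> units, and the zigzags sit at its two ends, at offsets about
  \<open>- s\<close> and \<open>s\<close>. Room for the slope is made by giving up 2 in each step of
  each zigzag, which costs about \<open>d / N\<close> flips in all. Bringing the zigzags to these
  offsets costs about \<open>5 * N / 4\<close> more. Balancing the two losses makes \<open>N\<close>
  of order \<open>sqrt d\<close> and explains the error term \<open>4 * sqrt d\<close>. Central
  symmetry matters at the centre only. No triangle has it in its interior, so a lift of span at most
  \<open>n\<close> always exists. A flipped diameter exchanges a single pair of triangles, and
  corrections of size at most \<open>N\<close> on triangles with a diameter keep this change, too,
  within \<open>2 * N\<close>.\<close>

definition area :: "complex \<Rightarrow> complex \<Rightarrow> complex \<Rightarrow> real" where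
  "area a b c = Re (b - a) * Im (c - a) - Im (b - a) * Re (c - a)"

lemma left_of_area: "left_of a b c \<longleftrightarrow> area a b c > 0"
  by (simp add: left_of_def area_def)

lemma area_rotate: "area a b c = area b c a"
  by (simp add: area_def algebra_simps)

text \<open>Convexity is given for sides only. Seen from \<open>p i\<close>, with the side to
  \<open>p (Suc i)\<close> as reference direction, positivity spreads to all triples by induction on
  \<open>k\<close>.\<close>

lemma convex_polygon_area_pos:
  assumes "convex_polygon n p" "i < j" "j < k" "k < n"
  shows "area (p i) (p j) (p k) > 0"
proof -
  have side: "area (p u) (p (Suc u)) (p v) > 0" if "Suc u < n" "v < n" "v \<noteq> u" "v \<noteq> Suc u" for u v
  proof -
    have "Suc u mod n = Suc u" "u < n" using that by simp_all
    moreover have "\<forall>i<n. \<forall>j<n. j \<noteq> i \<longrightarrow> j \<noteq> Suc i mod n \<longrightarrow> area (p i) (p (Suc i mod n)) (p j) > 0"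
      using assms(1) unfolding convex_polygon_def left_of_area by blast
    ultimately show ?thesis using that by metis
  qed
  have step: "area (p i) (p u) (p (Suc u)) > 0" if "i < u" "Suc u < n" for u
    using side[of u i] that by (simp add: area_rotate[of "p i"])
  have base: "area (p i) (p (Suc i)) (p u) > 0" if "Suc i < u" "u < n" for u
    using side[of i u] that by auto
  show ?thesis
  proof (cases "j = Suc i")
    case True
    then show ?thesis using base assms by auto
  next
    case False
    then have j: "Suc i < j" using assms by auto
    show ?thesis using assms(3,4)
    proof (induction k rule: less_induct)
      case (less k)
      show ?case
      proof (cases "k = Suc j")
        case True
        then show ?thesis using step assms less by auto
      next
        case False
        then obtain l where l: "k = Suc l" "j < l" using less.prems by (cases k) auto
        \<comment> \<open>Three-term Grassmann-Pluecker relation. For \<open>e = p (Suc i)\<close>,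
          \<open>x = p j\<close>, \<open>y = p l\<close>, \<open>z = p k\<close> the four areas on
          the right are positive by \<open>base\<close>, \<open>step\<close> and induction.\<close>
        have id: "area a e y * area a x z = area a e x * area a y z + area a e z * area a x y"
          for a e x y z by (simp add: area_def algebra_simps)
        have "area (p i) (p (Suc i)) (p l) * area (p i) (p j) (p k) > 0"
          using base[of j] base[of l] base[of k] step[of l] less.IH[of l] l j less.prems
          by (subst id) (auto intro!: add_pos_pos)
        moreover have "area (p i) (p (Suc i)) (p l) > 0" using base[of l] l j less.prems by auto
        ultimately show ?thesis using zero_less_mult_pos by blast
      qed
    qed
  qed
qed

text \<open>The intersection point is explicit: on each diagonal the endpoints are weighted by the
  areas cut off on the opposite side, and \<open>S\<close> is twice the area of the
  quadrilateral.\<close>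

lemma diagonals_meet:
  assumes "area a b c > 0" "area a b d > 0" "area a c d > 0" "area b c d > 0"
  shows "open_segment a c \<inter> open_segment b d \<noteq> {}"
proof -
  define S where "S = area b c d + area a b d"
  have S: "S = area a c d + area a b c" by (simp add: S_def area_def algebra_simps)
  have pos: "S > 0" using assms by (simp add: S_def)
  define z where "z = (1 - area a b d / S) *\<^sub>R a + (area a b d / S) *\<^sub>R c"
  have ne: "a \<noteq> c" "b \<noteq> d" using assms by (auto simp: area_def)
  have z1: "S *\<^sub>R z = area b c d *\<^sub>R a + area a b d *\<^sub>R c"
    using pos unfolding z_def scaleR_add_right scaleR_scaleR by (simp add: right_diff_distrib S_def)
  have "S *\<^sub>R z = area a c d *\<^sub>R b + area a b c *\<^sub>R d"
    unfolding z1 by (simp add: complex_eq_iff area_def algebra_simps)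
  then have "S *\<^sub>R z = S *\<^sub>R ((1 - area a b c / S) *\<^sub>R b + (area a b c / S) *\<^sub>R d)"
    using pos unfolding scaleR_add_right scaleR_scaleR by (simp add: right_diff_distrib S)
  then have z2: "z = (1 - area a b c / S) *\<^sub>R b + (area a b c / S) *\<^sub>R d"
    using pos by simp
  have "0 < area a b d / S" "area a b d / S < 1" "0 < area a b c / S" "area a b c / S < 1"
    using assms pos S_def S by (simp_all add: divide_simps)
  then have "z \<in> open_segment a c" "z \<in> open_segment b d"
    unfolding in_segment using ne z_def z2 by blast+
  then show ?thesis by blast
qed

text \<open>\<open>area x y\<close> is affine and vanishes on the line through \<open>x\<close> and
  \<open>y\<close>, but a proper convex combination of two values of one sign, not both zero, is
  nonzero.\<close>

lemma separated_segments_disjoint: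
  assumes "area x y u \<ge> 0 \<and> area x y v \<ge> 0 \<or> area x y u \<le> 0 \<and> area x y v \<le> 0"
    and "area x y u \<noteq> 0 \<or> area x y v \<noteq> 0"
  shows "open_segment x y \<inter> open_segment u v = {}"
proof (rule ccontr)
  assume "\<not> ?thesis"
  then obtain z where z: "z \<in> open_segment x y" "z \<in> open_segment u v" by blast
  obtain t where t: "0 < t" "t < 1" "z = (1 - t) *\<^sub>R u + t *\<^sub>R v" using z(2) by (auto simp: in_segment)
  obtain r where r: "z = (1 - r) *\<^sub>R x + r *\<^sub>R y" using z(1) by (auto simp: in_segment)
  have "area x y z = 0" unfolding r by (simp add: area_def algebra_simps)
  moreover have "area x y z = (1 - t) * area x y u + t * area x y v"
    unfolding t(3) by (simp add: area_def algebra_simps)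
  ultimately have eq: "(1 - t) * area x y u + t * area x y v = 0" by simp
  from assms(1) show False
  proof
    assume h: "area x y u \<ge> 0 \<and> area x y v \<ge> 0"
    then have "(1 - t) * area x y u \<ge> 0" "t * area x y v \<ge> 0" using t by auto
    then have "(1 - t) * area x y u = 0" "t * area x y v = 0" using eq by linarith+
    then show False using t assms(2) by auto
  next
    assume h: "area x y u \<le> 0 \<and> area x y v \<le> 0"
    then have "(1 - t) * area x y u \<le> 0" "t * area x y v \<le> 0"
      using t by (auto simp: mult_nonneg_nonpos)
    then have "(1 - t) * area x y u = 0" "t * area x y v = 0" using eq by linarith+
    then show False using t assms(2) by auto
  qed
qed

lemma crossing_if_interleaved:
  assumes "convex_polygon n p" "a < b" "b < c" "c < d" "d < n"
  shows "crossing p {a, c} {b, d}"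
proof -
  have "open_segment (p a) (p c) \<inter> open_segment (p b) (p d) \<noteq> {}"
    by (rule diagonals_meet; rule convex_polygon_area_pos[OF assms(1)]; use assms in auto)
  moreover have "{a, c} \<noteq> {b, d}" using assms by (auto simp: doubleton_eq_iff)
  ultimately show ?thesis unfolding crossing_def by blast
qed

lemma crossing_sym: "crossing p e f \<Longrightarrow> crossing p f e"
  unfolding crossing_def by (metis inf_commute)

text \<open>If the indices do not interleave, then \<open>u\<close> and \<open>v\<close> lie in the
  same closed arc cut off by the chord, hence weakly on one side of it.\<close>

lemma no_meet_if_not_interleaved:
  assumes "convex_polygon n p" "x < y" "y < n" "u < v" "v < n" "{x, y} \<noteq> {u, v}"
    and "\<not> (x < u \<and> u < y \<and> y < v)" "\<not> (u < x \<and> x < v \<and> v < y)"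
  shows "open_segment (p x) (p y) \<inter> open_segment (p u) (p v) = {}"
proof -
  have pos: "area (p x) (p y) (p w) > 0" if "w < x \<or> y < w" "w < n" for w
    using that convex_polygon_area_pos[OF assms(1), of w x y] assms(2,3)
      convex_polygon_area_pos[OF assms(1), of x y w] area_rotate[of "p w" "p x" "p y"] by auto
  have neg: "area (p x) (p y) (p w) < 0" if "x < w" "w < y" for w
  proof -
    have "area (p x) (p y) (p w) = - area (p x) (p w) (p y)" by (simp add: area_def algebra_simps)
    then show ?thesis using convex_polygon_area_pos[OF assms(1) that assms(3)] by simp
  qed
  have zero: "area (p x) (p y) (p w) = 0" if "w = x \<or> w = y" for w
    using that by (auto simp: area_def)
  have neq: "x \<noteq> u \<or> y \<noteq> v" using assms(6) by auto
  have sgn: "(w < x \<or> y < w) \<or> (x < w \<and> w < y) \<or> (w = x \<or> w = y)" for w by linarith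
  consider "x \<le> u" "v \<le> y" | "u \<le> x \<or> y \<le> u" "v \<le> x \<or> y \<le> v"
    using assms(2,4,7,8) by linarith
  then show ?thesis
  proof cases
    case 1
    have "area (p x) (p y) (p u) \<le> 0" using 1 assms(2,4) neg[of u] zero[of u]
      by (cases "u = x") simp_all
    moreover have "area (p x) (p y) (p v) \<le> 0" using 1 assms(2,4) neg[of v] zero[of v]
      by (cases "v = y") simp_all
    moreover have "area (p x) (p y) (p u) \<noteq> 0 \<or> area (p x) (p y) (p v) \<noteq> 0"
      using 1 neq assms(2,4) neg[of u] neg[of v] by (cases "u = x") simp_all
    ultimately show ?thesis using separated_segments_disjoint by blast
  next
    case 2
    have "area (p x) (p y) (p u) \<ge> 0"
      using 2(1) less_trans[OF assms(4,5)] pos[of u] zero[of u] by (cases "u = x \<or> u = y") fastforce+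
    moreover have "area (p x) (p y) (p v) \<ge> 0"
      using 2(2) assms(5) pos[of v] zero[of v] by (cases "v = x \<or> v = y") fastforce+
    moreover have "area (p x) (p y) (p u) \<noteq> 0 \<or> area (p x) (p y) (p v) \<noteq> 0"
    proof (cases "u = x \<or> u = y")
      case True
      then have "v < x \<or> y < v" using 2 neq assms(2,4) by auto
      then show ?thesis using pos[of v] assms(5) by simp
    next
      case False
      then have "u < x \<or> y < u" using 2 by auto
      then show ?thesis using pos[of u] assms(4,5) by simp
    qed
    ultimately show ?thesis using separated_segments_disjoint by blast
  qed
qed

lemma crossing_interleaved:
  assumes "convex_polygon n p" "crossing p {x, y} {u, v}" "x < y" "y < n" "u < v" "v < n"
  shows "x < u \<and> u < y \<and> y < v \<or> u < x \<and> x < v \<and> v < y"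
proof (rule ccontr)
  assume neg: "\<not> ?thesis"
  have ne: "{x, y} \<noteq> {u, v}" using assms(2) by (auto simp: crossing_def)
  obtain x' y' u' v' where h: "{x, y} = {x', y'}" "{u, v} = {u', v'}"
    "open_segment (p x') (p y') \<inter> open_segment (p u') (p v') \<noteq> {}"
    using assms(2) unfolding crossing_def by metis
  have "open_segment (p x') (p y') = open_segment (p x) (p y)"
    "open_segment (p u') (p v') = open_segment (p u) (p v)"
    using h(1,2) by (auto simp: doubleton_eq_iff open_segment_commute)
  then show False
    using no_meet_if_not_interleaved[OF assms(1,3,4,5,6) ne] neg h(3) by metis
qed

section \<open>The weights\<close>

locale weight =
  fixes n m s :: int
  assumes m_pos: "0 < m" and m_less: "m < n" and s_ge: "2 \<le> s"
begin

text \<open>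
  Write \<open>l_i\<close> for the vertex \<open>i < m\<close> and \<open>r_y\<close> for the vertex \<open>n - y\<close> where \<open>1 \<le> y \<le> n - m\<close>, and
  \<open>l_i'\<close>, \<open>r_y'\<close> for their translates by \<open>n\<close>. In the first zigzag \<open>l_i\<close> is joined to \<open>r_(i + s)\<close>, in
  the second one \<open>l_i'\<close> is joined to \<open>r_(i - s)\<close>. The triangle \<open>l_a l_b r_y\<close> has weight \<open>U a b y\<close>,
  \<open>r_y l_a' l_b'\<close> has weight \<open>D a b y\<close>, \<open>l_a l_b l_c\<close> has weight \<open>t (b - a) (c - b)\<close>, and \<open>r_x l_i' r_y'\<close>
  has weight \<open>K x i y\<close> up to a correction for diameters. The ramp \<open>R\<close> interpolates between the two
  zigzags. All weights are a rational solution of the linear program dual to the distance, scaled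
  by \<open>2 * N\<close> to make them integers.
\<close>

definition N :: int where "N = 2 * s - 1"

definition R :: "int \<Rightarrow> int" where
  "R k = max 0 (min (2 * N) (2 * (k + s - 1)))"

text \<open>The first zigzag joins \<open>l_(y - s)\<close> to \<open>r_y\<close>, so the window
  \<open>a \<le> y - s \<and> y - s < b\<close> tests whether this edge leaves \<open>r_y\<close>
  between \<open>l_a\<close> and \<open>l_b\<close>. For \<open>b = a + 1\<close> it selects the
  zigzag's own triangles.\<close>

definition U :: "int \<Rightarrow> int \<Rightarrow> int \<Rightarrow> int" where
  "U a b y =
    (if b = a + 1 then (if a \<le> y - s \<and> y - s < b then 2 - 2 * N else 0)
     else if b = a + 2 then
       (if a \<le> y - s \<and> y - s < b then 2 - 2 * N else min 0 (2 - (R (b - y) - R (a - y))))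
     else (if a \<le> y - s \<and> y - s < b then - N else N - (R (b - y) - R (a - y)))
       - (if b - a > 2 * s \<and> y < b - s then N else 0))"

text \<open>Downward triangles mirror upward ones under \<open>l \<mapsto> - l\<close>, \<open>r \<mapsto> - r - 1\<close>.\<close>

definition D :: "int \<Rightarrow> int \<Rightarrow> int \<Rightarrow> int" where
  "D a b y = (if b = a + 1 then 2 * N else 0) - U (- b) (- a) (- y - 1)"

definition t :: "int \<Rightarrow> int \<Rightarrow> int" where
  "t p q = (if q = 1 then (if p = 2 then N else 2 * N) else if p = 1 \<and> q = 2 then N else 0)"

definition K :: "int \<Rightarrow> int \<Rightarrow> int \<Rightarrow> int" where
  "K x l y = 2 * N * (1 - of_bool (l - y > - s) - of_bool (l - x > s))"

section \<open>Case tables and mirror symmetry of the weights\<close>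

lemma R_cases:
  "R k = 0 \<and> k \<le> 1 - s
  \<or> R k = 2 * (k + s - 1) \<and> 1 - s \<le> k \<and> k \<le> s
  \<or> R k = 2 * N \<and> s \<le> k"
  using s_ge unfolding R_def N_def by (simp add: max_def min_def)

lemma N_eq: "N = 2 * s - 1" "3 \<le> N" using s_ge unfolding N_def by simp_all

text \<open>With \<open>U\<close> and \<open>R\<close> flattened into linear alternatives, each
  quadrilateral bound is a finite case analysis in linear integer arithmetic. The last alternative
  collects degenerate arguments.\<close>

lemma U_cases: "b = a + 1 \<and> a = y - s \<and> U a b y = 2 - 2 * N
  \<or> b = a + 1 \<and> a \<noteq> y - s \<and> U a b y = 0
  \<or> b = a + 2 \<and> a \<le> y - s \<and> y - s < b \<and> U a b y = 2 - 2 * N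
  \<or> b = a + 2 \<and> (y - s < a \<or> b \<le> y - s) \<and> U a b y = 0 \<and> R (b - y) - R (a - y) \<le> 2
  \<or> b = a + 2 \<and> (y - s < a \<or> b \<le> y - s) \<and> U a b y = 2 - (R (b - y) - R (a - y)) \<and> R (b - y) - R (a - y) \<ge> 2
  \<or> b \<ge> a + 3 \<and> a \<le> y - s \<and> y - s < b \<and> (b - a \<le> 2 * s \<or> b - s \<le> y) \<and> U a b y = - N
  \<or> b \<ge> a + 3 \<and> (y - s < a \<and> (b - a \<le> 2 * s \<or> b - s \<le> y) \<or> b \<le> y - s) \<and> U a b y = N - (R (b - y) - R (a - y))
  \<or> b - a > 2 * s \<and> y < a + s \<and> U a b y = - (R (b - y) - R (a - y))
  \<or> b - a > 2 * s \<and> a + s \<le> y \<and> y < b - s \<and> U a b y = - 2 * N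
  \<or> b \<le> a" using s_ge unfolding U_def by auto

text \<open>The ramp is antisymmetric about 1/2, not 0. This is the source of the \<open>- 1\<close>
  in the mirror map, which exchanges the offsets \<open>- s\<close>, \<open>1 - s\<close> of the
  first zigzag with \<open>s + 1\<close>, \<open>s\<close> of the second.\<close>

lemma R_one_minus: "R (1 - k) = 2 * N - R k"
  using s_ge unfolding R_def N_def by (simp add: max_def min_def)

text \<open>The defect of \<open>t\<close> under reflection is \<open>2 * N\<close> per unit side,
  precisely what the extra term in \<open>D\<close> compensates. So \<open>quad_RLLL\<close> is the
  reflected \<open>quad_LLLR\<close>.\<close>

lemma t_mirror: "0 < p \<Longrightarrow> 0 < q \<Longrightarrow>
  t p q + t q p = (if p = 1 then 2 * N else 0) + (if q = 1 then 2 * N else 0)"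
  unfolding t_def by auto

text \<open>
  The following lemmas are named after the types, in cyclic order, of the four vertices of the
  quadrilateral in which a diagonal is exchanged.
\<close>

lemma quad_LLLL: "a < b \<Longrightarrow> b < c \<Longrightarrow> c < d \<Longrightarrow>
  \<bar>t (b - a) (d - b) + t (c - b) (d - c) - t (b - a) (c - b) - t (c - a) (d - c)\<bar> \<le> 2 * N"
  using N_eq unfolding t_def by (smt (verit))

lemma quad_LLLR: "a < b \<Longrightarrow> b < c \<Longrightarrow>
  \<bar>U a b y + U b c y - t (b - a) (c - b) - U a c y\<bar> \<le> 2 * N"
  using R_cases[of "a - y"] R_cases[of "b - y"] R_cases[of "c - y"] N_eq
    U_cases[of b a y] U_cases[of c b y] U_cases[of c a y]
  unfolding t_def by (smt (z3))

text \<open>This is where the slope is paid for: with \<open>b = a + 1\<close>, \<open>U\<close>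
  jumping from \<open>2 - 2 * N\<close> to 0 and the ramp adding 2, the bound is attained.\<close>

lemma quad_LLRR: "a < b \<Longrightarrow> y < x \<Longrightarrow>
  \<bar>U a b y + (R (b - y) - R (a - y)) - U a b x\<bar> \<le> 2 * N"
  using R_cases[of "a - y"] R_cases[of "b - y"] R_cases[of "a - x"] R_cases[of "b - x"] N_eq
    U_cases[of b a x] U_cases[of b a y]
  by (smt (z3))

lemma quad_RLLL:
  assumes "a < b" "b < c"
  shows "\<bar>D a c y + t (b - a) (c - b) - D a b y - D b c y\<bar> \<le> 2 * N"
  using quad_LLLR[of "- c" "- b" "- a" "- y - 1"] t_mirror[of "b - a" "c - b"] assms
  unfolding D_def by (smt (z3))

lemma R_mirror: "R (- a - (- y - 1)) = 2 * N - R (a - y)"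
  using R_one_minus[of "a - y"] by (simp add: algebra_simps)

lemma quad_RRLL:
  assumes "a < b" "y < x"
  shows "\<bar>D a b y - D a b x + (R (b - x) - R (a - x))\<bar> \<le> 2 * N"
  using quad_LLRR[of "- b" "- a" "- x - 1" "- y - 1"] assms R_mirror[of a x] R_mirror[of b x]
  unfolding D_def by (simp add: algebra_simps)

text \<open>As a function of \<open>l\<close>, \<open>K x l y\<close> drops by \<open>2 * N\<close>
  just after \<open>y - s\<close> and just after \<open>x + s\<close>. These are the windows of
  \<open>U a b y\<close> and of \<open>D a b x\<close>, whose extreme values \<open>K\<close>
  thereby absorbs in \<open>quad_RLLR\<close>.\<close>

lemma K_cases: "(y - s < a \<or> b \<le> y - s) \<and> (x + s < a \<or> b \<le> x + s) \<and> k = 0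
  \<or> (a \<le> y - s \<and> y - s < b) \<and> (x + s < a \<or> b \<le> x + s) \<and> k = 2 * N
  \<or> (y - s < a \<or> b \<le> y - s) \<and> (a \<le> x + s \<and> x + s < b) \<and> k = 2 * N
  \<or> (a \<le> y - s \<and> y - s < b) \<and> (a \<le> x + s \<and> x + s < b) \<and> k = 4 * N"
  if "k = K x a y - K x b y" "a < b"
  using that unfolding K_def of_bool_def
  by (cases "a - y > - s"; cases "a - x > s"; cases "b - y > - s"; cases "b - x > s"; simp; linarith)

lemma quad_RLLR:
  assumes "a < b" "y < x"
  shows "\<bar>D a b y - U a b x - (K y a x - K y b x)\<bar> \<le> 2 * N"
  using assms R_cases[of "a - y"] R_cases[of "b - y"] R_cases[of "a - x"] R_cases[of "b - x"] N_eq
    U_cases[of b a x] U_cases[of "- a" "- b" "- y - 1"] R_mirror[of a y] R_mirror[of b y]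
    K_cases[OF refl assms(1), of x y]
  unfolding D_def by (smt (z3))

text \<open>When the two right vertices are antipodal, both \<open>K\<close> triangles carry the
  correction \<open>N - R\<close>; the difference of the corrections is the additional ramp
  term.\<close>

lemma quad_RLLR_diameter:
  assumes "a < b"
  shows "\<bar>D a b y - U a b y - (K y a y - K y b y) - (R (b - y) - R (a - y))\<bar> \<le> 2 * N"
  using assms R_cases[of "a - y"] R_cases[of "b - y"] N_eq
    U_cases[of b a y] U_cases[of "- a" "- b" "- y - 1"] R_mirror[of a y] R_mirror[of b y]
    K_cases[OF refl assms(1), of y y]
  unfolding D_def by (smt (z3))

lemma R_range: "0 \<le> R k" "R k \<le> 2 * N"
  using N_eq unfolding R_def by simp_all

lemma R_mono: "k \<le> l \<Longrightarrow> R k \<le> R l"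
  unfolding R_def by simp

lemma t_range: "0 \<le> t i j" "t i j \<le> 2 * N"
  using N_eq unfolding t_def by simp_all

text \<open>The second bound, like that of \<open>D_range\<close>, serves quadrilaterals with a
  diameter as a side, where one triangle carries the correction \<open>N - R\<close>.\<close>

lemma U_range: "a < b \<Longrightarrow> \<bar>U a b y\<bar> \<le> 2 * N \<and> \<bar>U a b y + N - R (a - y)\<bar> \<le> 2 * N"
  using R_cases[of "a - y"] R_cases[of "b - y"] N_eq U_cases[of b a y] by (smt (z3))

lemma D_range:
  assumes "a < b"
  shows "\<bar>D a b y - (if b = a + 1 then 2 * N else 0)\<bar> \<le> 2 * N"
    and "\<bar>D a b y - (if b = a + 1 then 2 * N else 0) + N - R (b - y)\<bar> \<le> 2 * N"
  using U_range[of "- b" "- a" "- y - 1"] R_mirror[of b y] assms unfolding D_def by auto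

section \<open>The full weight function and its variation over quadrilaterals\<close>

definition w :: "int \<times> int \<times> int \<Rightarrow> int" where
  "w = (\<lambda>(a, b, c).
    if a < m then
      if c < m then t (b - a) (c - b)
      else if c < n then (if b < m then U a b (n - c) else R (a - (n - c)) - 2 * N)
      else if b < m then 0
      else if b < n then (if c = a + n then N - R (a - (n - b)) else 0)
      else if c = b + 1 then 2 * N else 0
    else if c < n then 0
    else if c < n + m then (if b < n then R (c - n - (n - a)) else D (b - n) (c - n) (n - a))
    else if b < n then (if c = a + n then N else 2 * N)
    else if b < n + m then
      K (n - a) (b - n) (2 * n - c) + (if c = a + n then N - R (b - n - (2 * n - c)) else 0)
    else if c = a + n then - N else - 2 * N)"

lemma K_diff:
  "\<lbrakk>x \<le> x'; y \<le> y'\<rbrakk> \<Longrightarrow> K x l y = K x' l y \<or> K x l y = K x' l y - 2 * N"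
  "\<lbrakk>x \<le> x'; y \<le> y'\<rbrakk> \<Longrightarrow> K x l y = K x l y' \<or> K x l y = K x l y' - 2 * N"
  "\<bar>K x l y\<bar> \<le> 2 * N"
  using N_eq unfolding K_def of_bool_def by (auto simp: algebra_simps)

lemma cocycle_low_L:
  assumes "0 \<le> a" "a < m" "a < b" "b < n" "b < c" "c < e" "e \<le> a + n"
  shows "\<bar>w (a, b, e) + w (b, c, e) - w (a, b, c) - w (a, c, e)\<bar> \<le> 2 * N"
proof -
  consider "e < m" | "c < m" "m \<le> e" "e < n" | "c < m" "n \<le> e"
    | "b < m" "m \<le> c" "e < n" | "b < m" "m \<le> c" "c < n" "n \<le> e" | "b < m" "n \<le> c"
    | "m \<le> b" "e < n" | "m \<le> b" "c < n" "n \<le> e" | "m \<le> b" "n \<le> c"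
    using assms by linarith
  then show ?thesis
  proof cases
    case 1
    then show ?thesis using quad_LLLL[of a b c e] assms m_less by (simp add: w_def)
  next
    case 2
    then show ?thesis using quad_LLLR[of a b c "n - e"] assms m_less by (simp add: w_def)
  next
    case 3
    then show ?thesis using t_range[of "b - a" "c - b"] assms m_less by (simp add: w_def)
  next
    case 4
    then show ?thesis using quad_LLRR[of a b "n - e" "n - c"] assms m_less by (simp add: w_def)
  next
    case 5
    then show ?thesis using U_range[of a b "n - c"] assms m_less by (auto simp: w_def)
  next
    case 6
    then show ?thesis using N_eq assms m_less by (simp add: w_def)
  next
    case 7
    then show ?thesis using R_range assms m_less by (simp add: w_def)
  next
    case 8
    \<comment> \<open>From \<open>e - n \<le> a\<close> and \<open>b < c\<close> the two ramp values
      are ordered, so their difference can only reduce the constant \<open>2 * N\<close>.\<close>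
    then show ?thesis
      using R_range[of "a - (n - c)"] R_range[of "e - n - (n - b)"] N_eq assms m_less
        R_mono[of "e - n - (n - b)" "a - (n - c)"] by (auto simp: w_def algebra_simps)
  next
    case 9
    show ?thesis
    proof (cases "e = a + n")
      case True
      then show ?thesis using 9 D_range(2)[of "c - n" a "n - b"] assms m_less by (auto simp: w_def)
    next
      case False
      then show ?thesis
        using 9 D_range(1)[of "c - n" "e - n" "n - b"] assms m_less by (auto simp: w_def)
    qed
  qed
qed

lemma cocycle_low_R:
  assumes "m \<le> a" "a < n" "a < b" "b < n" "b < c" "c < e" "e \<le> a + n"
  shows "\<bar>w (a, b, e) + w (b, c, e) - w (a, b, c) - w (a, c, e)\<bar> \<le> 2 * N"
proof -
  consider "e < n" | "c < n" "n \<le> e" "e < n + m" | "c < n" "n + m \<le> e"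
    | "n \<le> c" "e < n + m" | "n \<le> c" "c < n + m" "n + m \<le> e" | "n + m \<le> c"
    using assms by linarith
  then show ?thesis
  proof cases
    case 1
    then show ?thesis using N_eq assms m_less by (simp add: w_def)
  next
    case 2
    then show ?thesis using R_range assms m_less by (simp add: w_def)
  next
    case 3
    then show ?thesis using N_eq assms m_less m_pos by (simp add: w_def)
  next
    case 4
    then show ?thesis using quad_RRLL[of "c - n" "e - n" "n - b" "n - a"] assms m_less by (simp add: w_def)
  next
    case 5
    then show ?thesis using R_range[of "c - n - (n - a)"] N_eq assms m_less m_pos
        K_diff(1)[of "n - b" "n - a" "2 * n - e" "2 * n - e" "c - n"]
      by (auto simp: w_def)
  next
    case 6
    then show ?thesis using N_eq assms m_less m_pos by (auto simp: w_def)
  qed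
qed

text \<open>From \<open>n \<le> b\<close> on, the triangle \<open>bce\<close> starts outside the
  fundamental range and is replaced by its antipode.\<close>

lemma cocycle_high:
  assumes "0 \<le> a" "a < n" "n \<le> b" "b < c" "c < e" "e \<le> a + n"
  shows "\<bar>w (a, b, e) + w (b - n, c - n, e - n) - w (a, b, c) - w (a, c, e)\<bar> \<le> 2 * N"
proof -
  consider "a < m" | "m \<le> a" "e < n + m" | "m \<le> a" "c < n + m" "n + m \<le> e"
    | "m \<le> a" "b < n + m" "n + m \<le> c" | "m \<le> a" "n + m \<le> b"
    using assms by linarith
  then show ?thesis
  proof cases
    case 1
    then show ?thesis
      using N_eq t_range[of "c - b" "e - c"] assms m_less by (auto simp: w_def) (auto simp: t_def)
  next
    case 2
    then show ?thesis using quad_RLLL[of "b - n" "c - n" "e - n" "n - a"] assms m_less by (simp add: w_def)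
  next
    case 3
    show ?thesis
    proof (cases "e = a + n")
      case True
      then show ?thesis using 3 quad_RLLR_diameter[of "b - n" "c - n" "n - a"] assms m_less by (simp add: w_def)
    next
      case False
      then show ?thesis
        using 3 quad_RLLR[of "b - n" "c - n" "n - a" "2 * n - e"] assms m_less by (simp add: w_def)
    qed
  next
    case 4
    then show ?thesis using R_range[of "b - n - (2 * n - e)"] N_eq assms m_less m_pos
        K_diff(2)[of "n - a" "n - a" "2 * n - e" "2 * n - c" "b - n"]
      by (auto simp: w_def)
  next
    case 5
    then show ?thesis using N_eq assms m_less m_pos by (auto simp: w_def)
  qed
qed

text \<open>This dictates the diameter corrections. For one left and one right vertex they cancel
  and leave \<open>K\<close>; for two right vertices they turn a change from \<open>2 * N\<close> to
  \<open>- 2 * N\<close> into one from \<open>N\<close> to \<open>- N\<close>.\<close>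

lemma diameter_low:
  assumes "0 \<le> a" "a < b" "b < n"
  shows "\<bar>w (b, a + n, b + n) - w (a, b, a + n)\<bar> \<le> 2 * N"
  using assms m_less m_pos N_eq K_diff(3)[of "n - b" a "n - b"]
  by (cases "b < m"; cases "a < m") (auto simp: w_def)

lemma diameter_high:
  assumes "0 \<le> a" "a < n" "n \<le> b" "b < a + n"
  shows "\<bar>w (b - n, a, b) - w (a, b, a + n)\<bar> \<le> 2 * N"
  using assms m_less m_pos N_eq K_diff(3)[of "n - a" "b - n" "n - a"]
  by (cases "b < n + m"; cases "a < m") (auto simp: w_def)

end

section \<open>Unrolling the polygon\<close>

locale cs_polygon =
  fixes d :: nat and p :: "nat \<Rightarrow> complex" and n :: int
  assumes convex: "convex_polygon (2 * d + 2) p" and n_eq: "n = int d + 1"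
begin

lemma n_pos: "0 < n" using n_eq by simp

definition vert :: "int \<Rightarrow> nat" where "vert x = nat (x mod (2 * n))"

definition edge :: "int \<Rightarrow> int \<Rightarrow> nat set" where "edge x y = {vert x, vert y}"

lemma edge_commute: "edge x y = edge y x"
  by (auto simp: edge_def)

lemma vert_less: "vert x < 2 * d + 2"
proof -
  have "x mod (2 * n) < 2 * n" "0 \<le> x mod (2 * n)" using n_pos by simp_all
  then show ?thesis unfolding vert_def using n_eq by linarith
qed

lemma vert_eq_iff: "vert x = vert y \<longleftrightarrow> 2 * n dvd x - y"
proof -
  have "0 \<le> x mod (2 * n)" "0 \<le> y mod (2 * n)" using n_pos by simp_all
  then show ?thesis unfolding vert_def by (simp add: eq_nat_nat_iff mod_eq_dvd_iff)
qed

lemma vert_int: "k < 2 * d + 2 \<Longrightarrow> vert (int k) = k"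
  unfolding vert_def using n_eq by simp

lemma vert_eq_imp: "vert x = vert y \<Longrightarrow> \<bar>x - y\<bar> < 2 * n \<Longrightarrow> x = y"
  unfolding vert_eq_iff using zdvd_imp_le[of "2 * n" "\<bar>x - y\<bar>"] by fastforce

lemma vert_add_cancel [simp]: "vert (x + z) = vert (y + z) \<longleftrightarrow> vert x = vert y"
  by (simp add: vert_eq_iff)

lemma vert_period [simp]: "vert (x + 2 * n) = vert x" "vert (x - 2 * n) = vert x"
  by (simp_all add: vert_eq_iff)

lemma vert_ne_antipode [simp]: "vert (x + n) \<noteq> vert x" "vert x \<noteq> vert (x + n)"
  using vert_eq_imp[of "x + n" x] n_pos by auto

lemma opposite_vert: "opposite d (vert x) = vert (x + n)"
proof -
  have "int (vert x) = x mod (2 * n)" unfolding vert_def using n_pos by simp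
  then have "int (opposite d (vert x)) = (x mod (2 * n) + n) mod (2 * n)"
    unfolding opposite_def using n_eq by (simp add: zmod_int algebra_simps)
  then have "int (opposite d (vert x)) = (x + n) mod (2 * n)" by (simp add: mod_add_left_eq)
  then show ?thesis unfolding vert_def by (metis nat_int)
qed

lemma opposite_edge: "opposite d ` edge x y = edge (x + n) (y + n)"
  by (simp add: edge_def opposite_vert)

lemma edge_crossing:
  assumes "a < b" "b < c" "c < e" "e < a + 2 * n"
  shows "crossing p (edge a c) (edge b e)"
proof -
  define M where "M = 2 * n"
  have M: "M > 0" "M = int (2 * d + 2)" using n_pos n_eq by (simp_all add: M_def)
  define sh where "sh x = x - M * (a div M)" for x
  have sh: "vert (sh x) = vert x" for x unfolding sh_def vert_eq_iff M_def by simp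
  have a0: "0 \<le> sh a" "sh a < M" using M by (simp_all add: sh_def minus_mult_div_eq_mod)
  have low: "vert x = nat x" if "0 \<le> x" "x < M" for x unfolding vert_def using that M_def by simp
  have high: "vert x = nat (x - M)" if "M \<le> x" "x < 2 * M" for x
    using low[of "x - M"] that vert_period(2)[of x] by (simp add: M_def)
  have ord: "sh a < sh b" "sh b < sh c" "sh c < sh e" "sh e < sh a + M"
    using assms by (simp_all add: sh_def M_def)
  have X: "crossing p {nat x, nat z} {nat y, nat w}"
    if "0 \<le> x" "x < y" "y < z" "z < w" "w < M" for x y z w
    by (rule crossing_if_interleaved[OF convex]) (use that M in auto)
  have "crossing p {vert (sh a), vert (sh c)} {vert (sh b), vert (sh e)}"
  proof -
    \<comment> \<open>The cases count the vertices that have wrapped past \<open>M\<close>; after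
      reduction these come first in the order of indices.\<close>
    consider "sh e < M" | "sh c < M" "M \<le> sh e" | "sh b < M" "M \<le> sh c" | "M \<le> sh b"
      using ord by linarith
    then show ?thesis
    proof cases
      case 1
      then show ?thesis using X[of "sh a" "sh b" "sh c" "sh e"] ord a0 low by simp
    next
      case 2
      then show ?thesis using X[of "sh e - M" "sh a" "sh b" "sh c"] ord a0 low high crossing_sym
        by (simp add: insert_commute)
    next
      case 3
      then show ?thesis using X[of "sh c - M" "sh e - M" "sh a" "sh b"] ord a0 low high
        by (simp add: insert_commute)
    next
      case 4
      then show ?thesis using X[of "sh b - M" "sh c - M" "sh e - M" "sh a"] ord a0 low high crossing_sym
        by (simp add: insert_commute)
    qed
  qed
  then show ?thesis unfolding sh edge_def .
qed

lemma edges_ordered: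
  assumes "G \<in> edges (2 * d + 2)"
  shows "\<exists>x y. x < y \<and> y < 2 * d + 2 \<and> G = {x, y}"
proof -
  obtain x y where "x < 2 * d + 2" "y < 2 * d + 2" "x \<noteq> y" "G = {x, y}"
    using assms unfolding edges_def by blast
  then show ?thesis by (metis insert_commute linorder_neqE_nat)
qed

lemma crossing_lift:
  assumes "crossing p E F" "E \<in> edges (2 * d + 2)" "F \<in> edges (2 * d + 2)"
  obtains a b c e where "a < b" "b < c" "c < e" "e < a + 2 * n" "E = edge a c" "F = edge b e"
proof -
  obtain x y where x: "x < y" "y < 2 * d + 2" "E = {x, y}" using edges_ordered[OF assms(2)] by blast
  obtain u v where u: "u < v" "v < 2 * d + 2" "F = {u, v}" using edges_ordered[OF assms(3)] by blast
  have E: "E = edge (int x) (int y)" and F: "F = edge (int u) (int v)"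
    using x u by (simp_all add: edge_def vert_int)
  have b: "int y < 2 * n" "int v < 2 * n" using x(2) u(2) n_eq by linarith+
  consider "x < u" "u < y" "y < v" | "u < x" "x < v" "v < y"
    using crossing_interleaved[OF convex assms(1)[unfolded x(3) u(3)] x(1,2) u(1,2)] by blast
  then show ?thesis
  proof cases
    case 1
    show ?thesis by (rule that[of "int x" "int u" "int y" "int v"]) (use 1 b E F in simp_all)
  next
    case 2
    show ?thesis
    proof (rule that[of "int x" "int v" "int y" "int u + 2 * n"])
      show "F = edge (int v) (int u + 2 * n)" unfolding F edge_def by auto
    qed (use 2 b E in simp_all)
  qed
qed

text \<open>What the potential argument uses of a centrally symmetric triangulation, with crossings
  expressed by cyclic order of lifts.\<close>

definition good :: "nat set set \<Rightarrow> bool" where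
  "good T \<longleftrightarrow> T \<subseteq> edges (2 * d + 2)
    \<and> (\<forall>x y. edge x y \<in> T \<longrightarrow> edge (x + n) (y + n) \<in> T)
    \<and> (\<forall>a b c e. a < b \<longrightarrow> b < c \<longrightarrow> c < e \<longrightarrow> e < a + 2 * n \<longrightarrow> edge a c \<in> T \<longrightarrow> edge b e \<notin> T)"

lemma good_noncrossing:
  "good T \<Longrightarrow> a < b \<Longrightarrow> b < c \<Longrightarrow> c < e \<Longrightarrow> e < a + 2 * n \<Longrightarrow> edge a c \<in> T \<Longrightarrow> edge b e \<in> T \<Longrightarrow> False"
  unfolding good_def by blast

lemma edge_period [simp]: "edge (x + 2 * n) y = edge x y" "edge x (y + 2 * n) = edge x y"
  "edge (x - 2 * n) y = edge x y" "edge x (y - 2 * n) = edge x y"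
  by (simp_all add: edge_def)

lemma edge_shift_cases:
  "edge (x + k * n) (y + k * n) = edge x y \<or> edge (x + k * n) (y + k * n) = edge (x + n) (y + n)"
proof (cases "even k")
  case True
  then have "vert (z + k * n) = vert z" for z by (auto simp: vert_eq_iff)
  then show ?thesis by (simp add: edge_def)
next
  case False
  then obtain j where "k = 2 * j + 1" by (auto elim: oddE)
  then have "vert (z + k * n) = vert (z + n)" for z by (auto simp: vert_eq_iff algebra_simps)
  then show ?thesis by (simp add: edge_def)
qed

lemma good_shift: "good T \<Longrightarrow> edge x y \<in> T \<Longrightarrow> edge (x + k * n) (y + k * n) \<in> T"
  using edge_shift_cases[of x k y] unfolding good_def by auto

lemma good_if_cs_triangulation:
  assumes "cs_triangulation d p T"
  shows "good T"
proof -
  have T: "noncrossing_edges (2 * d + 2) p T" and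
    S: "\<And>x y. {x, y} \<in> T \<Longrightarrow> {opposite d x, opposite d y} \<in> T"
    using assms unfolding cs_triangulation_def triangulation_def by blast+
  have "T \<subseteq> edges (2 * d + 2)" and X: "\<And>E F. E \<in> T \<Longrightarrow> F \<in> T \<Longrightarrow> \<not> crossing p E F"
    using T unfolding noncrossing_edges_def by blast+
  moreover have "edge (x + n) (y + n) \<in> T" if "edge x y \<in> T" for x y
    using S[of "vert x" "vert y"] that by (simp add: edge_def opposite_vert)
  moreover have "edge b e \<notin> T"
    if "a < b" "b < c" "c < e" "e < a + 2 * n" "edge a c \<in> T" for a b c e
    using edge_crossing[OF that(1-4)] X that(5) by blast
  ultimately show ?thesis unfolding good_def by blast
qed

lemma cs_triangulation_if_good:
  assumes "good T"
    and maximal: "\<And>x y. x < y \<Longrightarrow> y < x + 2 * n \<Longrightarrow> edge x y \<notin> T \<Longrightarrow> \<exists>F \<in> T. crossing p F (edge x y)"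
  shows "cs_triangulation d p T"
proof -
  have sub: "T \<subseteq> edges (2 * d + 2)" using assms(1) unfolding good_def by simp
  have "\<not> crossing p E F" if "E \<in> T" "F \<in> T" for E F
  proof
    assume "crossing p E F"
    moreover have "E \<in> edges (2 * d + 2)" "F \<in> edges (2 * d + 2)" using that sub by blast+
    ultimately obtain a b c e
      where "a < b" "b < c" "c < e" "e < a + 2 * n" "E = edge a c" "F = edge b e"
      by (rule crossing_lift)
    then show False using good_noncrossing[OF assms(1)] that by blast
  qed
  then have nc: "noncrossing_edges (2 * d + 2) p T" using sub by (simp add: noncrossing_edges_def)
  have "T' = T" if T': "noncrossing_edges (2 * d + 2) p T'" "T \<subseteq> T'" for T'
  proof (rule ccontr)
    assume "T' \<noteq> T"
    then obtain E where E: "E \<in> T'" "E \<notin> T" using T' by blast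
    then have "E \<in> edges (2 * d + 2)" using T' by (auto simp: noncrossing_edges_def)
    then obtain x y where xy: "x < y" "y < 2 * d + 2" "E = {x, y}"
      using edges_ordered by blast
    then have "E = edge (int x) (int y)" by (simp add: edge_def vert_int)
    then obtain F where "F \<in> T" "crossing p F E" using maximal[of "int x" "int y"] xy E n_eq by auto
    then show False using T' E by (auto simp: noncrossing_edges_def)
  qed
  moreover have "{opposite d x, opposite d y} \<in> T" if "{x, y} \<in> T" for x y
  proof -
    have "{x, y} \<in> edges (2 * d + 2)" using that sub by blast
    then have "x < 2 * d + 2" "y < 2 * d + 2" by (auto simp: edges_def doubleton_eq_iff)
    then have "x = vert (int x)" "y = vert (int y)" by (simp_all add: vert_int)
    then show ?thesis using that assms(1) unfolding good_def edge_def by (metis opposite_vert)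
  qed
  ultimately show ?thesis using nc by (simp add: cs_triangulation_def triangulation_def)
qed

section \<open>Edges modulo central symmetry\<close>

definition orbit :: "int \<Rightarrow> int \<Rightarrow> nat set set" where
  "orbit x z = {edge x z, edge (x + n) (z + n)}"

lemma orbit_commute: "orbit x z = orbit z x"
  by (simp add: orbit_def edge_commute)

lemma orbit_period [simp]: "orbit (x + 2 * n) z = orbit x z" "orbit x (z + 2 * n) = orbit x z"
   "orbit (x - 2 * n) z = orbit x z" "orbit x (z - 2 * n) = orbit x z"
  by (auto simp: orbit_def edge_def vert_eq_iff)

lemma orbit_shift: "edge x y \<in> orbit u v \<Longrightarrow> edge (x + k * n) (y + k * n) \<in> orbit u v"
proof -
  assume "edge x y \<in> orbit u v"
  moreover from this have "edge (x + n) (y + n) \<in> orbit u v"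
    unfolding orbit_def insert_iff empty_iff
  proof (elim disjE FalseE)
    assume "edge x y = edge u v"
    then have "edge (x + n) (y + n) = edge (u + n) (v + n)" using opposite_edge by metis
    then show "edge (x + n) (y + n) = edge u v \<or> edge (x + n) (y + n) = edge (u + n) (v + n) \<or> False" by simp
  next
    assume "edge x y = edge (u + n) (v + n)"
    then have "edge (x + n) (y + n) = edge (u + n + n) (v + n + n)" using opposite_edge by metis
    also have "\<dots> = edge u v" using edge_period[of u] by (simp add: add.assoc)
    finally show "edge (x + n) (y + n) = edge u v \<or> edge (x + n) (y + n) = edge (u + n) (v + n) \<or> False" by simp
  qed
  ultimately show ?thesis using edge_shift_cases[of x k y] by metis
qed

text \<open>If \<open>edge a b\<close> were the antipode of \<open>edge a c\<close>, then
  \<open>b\<close> would be antipodal to \<open>a\<close> and \<open>a\<close> to \<open>c\<close>,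
  making \<open>b\<close> and \<open>c\<close> equal. Hence the sides of a quadrilateral survive the
  flip.\<close>

lemma adjacent_notin_orbit:
  assumes "vert a \<noteq> vert b" "vert b \<noteq> vert c"
  shows "edge a b \<notin> orbit a c"
proof
  assume "edge a b \<in> orbit a c"
  then have "vert a = vert (c + n)" "vert b = vert (a + n)"
    using assms by (auto simp: orbit_def edge_def doubleton_eq_iff)
  then have "vert b = vert (c + n + n)" by (metis vert_add_cancel)
  then show False using assms vert_period(1)[of c] by (simp add: add.assoc)
qed

text \<open>A lift of span at most \<open>n\<close> is unique up to translation by \<open>n\<close>.
  Matching the endpoints in reverse (\<open>case 2\<close>) forces a diameter, which an odd
  translation reverses.\<close>

lemma orbit_lift:
  assumes "edge a b \<in> orbit x z" "a < b" "b \<le> a + n" "x < z" "z \<le> x + n"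
  obtains k where "a + k * n = x" "b + k * n = z"
proof -
  have base: "\<exists>k. a + k * n = x \<and> b + k * n = z" if "edge a b = edge x z" "x < z" "z \<le> x + n" for x z
  proof -
    consider "vert a = vert x" "vert b = vert z" | "vert a = vert z" "vert b = vert x"
      using \<open>edge a b = edge x z\<close> by (auto simp: edge_def doubleton_eq_iff)
    then show ?thesis
    proof cases
      case 1
      obtain i where i: "x - a = 2 * n * i" using 1(1)[symmetric] unfolding vert_eq_iff by (elim dvdE)
      have "vert (b + 2 * n * i) = vert b" by (simp add: vert_eq_iff)
      then have "vert (b + 2 * n * i) = vert z" using 1(2) by simp
      then have "b + 2 * n * i = z" using assms that i by (intro vert_eq_imp) auto
      then show ?thesis using i by (intro exI[of _ "2 * i"]) (simp add: algebra_simps)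
    next
      case 2
      obtain i where i: "z - a = 2 * n * i" using 2(1)[symmetric] unfolding vert_eq_iff by (elim dvdE)
      have "vert (b + 2 * n * i) = vert b" by (simp add: vert_eq_iff)
      then have "vert (b + 2 * n * i) = vert (x + 2 * n)" using 2(2) by simp
      then have b: "b + 2 * n * i = x + 2 * n" using assms that i by (intro vert_eq_imp) auto
      then have "z = x + n" "b = a + n" using i assms that by linarith+
      then show ?thesis using i by (intro exI[of _ "2 * i - 1"]) (simp add: algebra_simps)
    qed
  qed
  consider "edge a b = edge x z" | "edge a b = edge (x + n) (z + n)"
    using assms(1) by (auto simp: orbit_def)
  then show ?thesis
  proof cases
    case 1
    then show ?thesis using base assms that by blast
  next
    case 2
    then obtain k where "a + k * n = x + n" "b + k * n = z + n" using base[of "x + n" "z + n"] assms by auto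
    then show ?thesis using that[of "k - 1"] by (simp add: algebra_simps)
  qed
qed

section \<open>The potential and its change under a flip\<close>

definition norm3 :: "int \<times> int \<times> int \<Rightarrow> int \<times> int \<times> int" where
  "norm3 = (\<lambda>(a, b, c). (a - n * (a div n), b - n * (a div n), c - n * (a div n)))"

text \<open>One representative per antipodal pair: \<open>c \<le> a + n\<close> fixes the cyclic
  starting point, and \<open>0 \<le> a < n\<close> the translate. Triangles around the centre have
  no such form; \<open>no_central_triangle\<close> excludes them.\<close>

definition tris :: "nat set set \<Rightarrow> (int \<times> int \<times> int) set" where
  "tris T = {(a, b, c). 0 \<le> a \<and> a < n \<and> a < b \<and> b < c \<and> c \<le> a + n
    \<and> edge a b \<in> T \<and> edge b c \<in> T \<and> edge a c \<in> T}"

definition uses :: "nat set set \<Rightarrow> int \<times> int \<times> int \<Rightarrow> bool" where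
  "uses R = (\<lambda>(a, b, c). edge a b \<in> R \<or> edge b c \<in> R \<or> edge a c \<in> R)"

lemma norm3_shift: "norm3 (a + k * n, b + k * n, c + k * n) = norm3 (a, b, c)"
  using n_pos by (simp add: norm3_def algebra_simps)

lemma norm3_id: "0 \<le> a \<Longrightarrow> a < n \<Longrightarrow> norm3 (a, b, c) = (a, b, c)"
  by (simp add: norm3_def)

lemma norm3_eq_shift: "\<exists>k. norm3 (a, b, c) = (a + k * n, b + k * n, c + k * n)"
  by (rule exI[of _ "- (a div n)"]) (simp add: norm3_def algebra_simps)

lemma norm3_gap: "norm3 (a, b, c) = norm3 (a', b', c') \<Longrightarrow> c - a = c' - a'"
  by (simp add: norm3_def)

lemma finite_tris: "finite (tris T)"
proof (rule finite_subset)
  show "tris T \<subseteq> {0..n} \<times> {0..2 * n} \<times> {0..2 * n}" unfolding tris_def by auto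
qed auto

lemma norm3_mem_tris:
  assumes "good T" "edge a b \<in> T" "edge b c \<in> T" "edge a c \<in> T" "a < b" "b < c" "c \<le> a + n"
  shows "norm3 (a, b, c) \<in> tris T"
proof -
  have "0 \<le> a - n * (a div n)" "a - n * (a div n) < n" using n_pos by (simp_all add: minus_mult_div_eq_mod)
  then show ?thesis
    using good_shift[OF assms(1), of _ _ "- (a div n)"] assms(2-)
    by (auto simp: tris_def norm3_def algebra_simps)
qed

lemma uses_shift: "uses (orbit x z) (a + k * n, b + k * n, c + k * n) \<longleftrightarrow> uses (orbit x z) (a, b, c)"
proof -
  have "edge (u + k * n) (v + k * n) \<in> orbit x z \<longleftrightarrow> edge u v \<in> orbit x z" for u v
    using orbit_shift[of u v x z k] orbit_shift[of "u + k * n" "v + k * n" x z "- k"] by auto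
  then show ?thesis by (simp add: uses_def)
qed

lemma uses_norm3: "uses (orbit x z) (norm3 (a, b, c)) \<longleftrightarrow> uses (orbit x z) (a, b, c)"
  using norm3_eq_shift[of a b c] uses_shift by metis

lemma tris_Diff: "tris (T - R) = {\<tau> \<in> tris T. \<not> uses R \<tau>}"
  by (auto simp: tris_def uses_def)

definition Phi :: "(int \<times> int \<times> int \<Rightarrow> int) \<Rightarrow> nat set set \<Rightarrow> int" where
  "Phi w T = sum w (tris T)"

text \<open>The potential is defined for arbitrary edge sets, so the two ends of a flip can be
  compared through their common remainder.\<close>

lemma Phi_Diff: "Phi w T = Phi w (T - R) + sum w {\<tau> \<in> tris T. uses R \<tau>}"
proof -
  have "tris T = tris (T - R) \<union> {\<tau> \<in> tris T. uses R \<tau>}" by (auto simp: tris_Diff)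
  then show ?thesis unfolding Phi_def
    using sum.union_disjoint[of "tris (T - R)" "{\<tau> \<in> tris T. uses R \<tau>}" w] finite_tris
    by (auto simp: tris_Diff)
qed

section \<open>Triangles incident to an edge\<close>

lemma inner_apex_unique:
  assumes "good T" "x < u" "u < z" "x < v" "v < z" "z < x + 2 * n"
    and "edge x u \<in> T" "edge u z \<in> T" "edge x v \<in> T" "edge v z \<in> T"
  shows "u = v"
  using good_noncrossing[OF assms(1), of x u v z] good_noncrossing[OF assms(1), of x v u z] assms
  by (metis linorder_less_linear)

lemma outer_apex_unique:
  assumes "good T" "x < z" "z < u" "u < x + 2 * n" "z < v" "v < x + 2 * n"
    and "edge z u \<in> T" "edge u x \<in> T" "edge z v \<in> T" "edge v x \<in> T"
  shows "u = v"
  using inner_apex_unique[of T z u "x + 2 * n" v] assms by simp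

text \<open>An edge that is no diameter borders one triangle on its short arc and one beyond it. The
  normal lift of the latter starts at \<open>x\<close> or at \<open>v - 2 * n\<close>, depending on
  the side beyond which the centre lies.\<close>

lemma tris_using_edge:
  assumes T: "good T" and "x < z" "z < x + n" "edge x z \<in> T"
    and u: "x < u" "u < z" "edge x u \<in> T" "edge u z \<in> T"
    and v: "z < v" "v < x + 2 * n" "edge z v \<in> T" "edge v x \<in> T"
    and outer: "outer = (x, z, v) \<and> v \<le> x + n \<or> outer = (v - 2 * n, x, z) \<and> z + n \<le> v"
  shows "{\<tau> \<in> tris T. uses (orbit x z) \<tau>} = {norm3 (x, u, z), norm3 outer}"
proof (intro equalityI subsetI)
  fix \<tau> assume "\<tau> \<in> {\<tau> \<in> tris T. uses (orbit x z) \<tau>}"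
  then obtain a b c where \<tau>: "\<tau> = (a, b, c)" "0 \<le> a" "a < n" "a < b" "b < c" "c \<le> a + n"
    "edge a b \<in> T" "edge b c \<in> T" "edge a c \<in> T"
    and us: "edge a b \<in> orbit x z \<or> edge b c \<in> orbit x z \<or> edge a c \<in> orbit x z"
    by (auto simp: tris_def uses_def)
  have nrm: "\<tau> = norm3 (a + k * n, b + k * n, c + k * n)" for k
    unfolding norm3_shift using \<tau> by (simp add: norm3_id)
  have sh: "edge (a + k * n) (b + k * n) \<in> T" "edge (b + k * n) (c + k * n) \<in> T"
    "edge (a + k * n) (c + k * n) \<in> T" for k
    using \<tau> good_shift[OF T] by blast+
  from us show "\<tau> \<in> {norm3 (x, u, z), norm3 outer}"
  proof (elim disjE)
    assume "edge a b \<in> orbit x z"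
    then obtain k where k: "a + k * n = x" "b + k * n = z"
      using orbit_lift[of a b x z] \<tau> assms by auto
    have "c + k * n = v"
      by (rule outer_apex_unique[OF T, of x z])
        (use k sh[of k] \<tau> assms n_pos in \<open>auto simp: edge_commute\<close>)
    moreover have "c + k * n \<le> x + n" using k \<tau> by linarith
    ultimately have "outer = (x, z, c + k * n)" using outer assms n_pos by auto
    then show ?thesis using nrm[of k] k by simp
  next
    assume "edge b c \<in> orbit x z"
    then obtain k where k: "b + k * n = x" "c + k * n = z"
      using orbit_lift[of b c x z] \<tau> assms by auto
    have "a + k * n + 2 * n = v"
      by (rule outer_apex_unique[OF T, of x z])
        (use k sh[of k] \<tau> assms n_pos in \<open>auto simp: edge_commute\<close>)
    moreover have "z \<le> a + k * n + n" using k \<tau> by linarith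
    ultimately have "outer = (a + k * n, x, z)" using outer assms n_pos by auto
    then show ?thesis using nrm[of k] k by simp
  next
    assume "edge a c \<in> orbit x z"
    then obtain k where k: "a + k * n = x" "c + k * n = z"
      using orbit_lift[of a c x z] \<tau> assms by auto
    have "b + k * n = u"
      by (rule inner_apex_unique[OF T, of x _ z])
        (use k sh[of k] \<tau> assms n_pos in \<open>auto simp: edge_commute\<close>)
    then show ?thesis using nrm[of k] k by simp
  qed
next
  fix \<tau> assume "\<tau> \<in> {norm3 (x, u, z), norm3 outer}"
  moreover have "norm3 (x, u, z) \<in> tris T" by (rule norm3_mem_tris) (use assms in auto)
  moreover have "norm3 outer \<in> tris T"
    using outer
  proof (elim disjE conjE)
    assume "outer = (x, z, v)" "v \<le> x + n"
    then show ?thesis using assms norm3_mem_tris[OF T, of x z v] by (simp add: edge_commute)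
  next
    assume "outer = (v - 2 * n, x, z)" "z + n \<le> v"
    then show ?thesis using assms norm3_mem_tris[OF T, of "v - 2 * n" x z]
      by (simp add: edge_commute)
  qed
  moreover have "uses (orbit x z) (norm3 (x, u, z))" unfolding uses_norm3 by (simp add: uses_def orbit_def)
  moreover have "uses (orbit x z) (norm3 outer)"
    using outer
  proof (elim disjE conjE)
    assume o: "outer = (x, z, v)"
    show ?thesis unfolding o uses_norm3 by (simp add: uses_def orbit_def)
  next
    assume o: "outer = (v - 2 * n, x, z)"
    show ?thesis unfolding o uses_norm3 by (simp add: uses_def orbit_def)
  qed
  ultimately show "\<tau> \<in> {\<tau> \<in> tris T. uses (orbit x z) \<tau>}" by blast
qed

lemma Phi_edge:
  assumes T: "good T" and "x < z" "z < x + n" "edge x z \<in> T"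
    and u: "x < u" "u < z" "edge x u \<in> T" "edge u z \<in> T"
    and v: "z < v" "v < x + 2 * n" "edge z v \<in> T" "edge v x \<in> T"
    and outer: "outer = (x, z, v) \<and> v \<le> x + n \<or> outer = (v - 2 * n, x, z) \<and> z + n \<le> v"
  shows "Phi w T = Phi w (T - orbit x z) + w (norm3 (x, u, z)) + w (norm3 outer)"
proof -
  \<comment> \<open>The outer triangle has strictly larger span, and \<open>norm3\<close> preserves
    spans.\<close>
  have "norm3 (x, u, z) \<noteq> norm3 outer"
    using outer v(1,2) norm3_gap[of x u z x z v] norm3_gap[of x u z "v - 2 * n" x z] by auto
  then show ?thesis using Phi_Diff[of w T "orbit x z"] tris_using_edge[OF assms] by simp
qed

text \<open>The two triangles at a diameter are antipodal and count once.\<close>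

lemma Phi_diameter:
  assumes T: "good T" and x: "edge x (x + n) \<in> T"
    and u: "x < u" "u < x + n" "edge x u \<in> T" "edge u (x + n) \<in> T"
  shows "Phi w T = Phi w (T - orbit x (x + n)) + w (norm3 (x, u, x + n))"
proof -
  have "{\<tau> \<in> tris T. uses (orbit x (x + n)) \<tau>} = {norm3 (x, u, x + n)}"
  proof (intro equalityI subsetI)
    fix \<tau> assume "\<tau> \<in> {\<tau> \<in> tris T. uses (orbit x (x + n)) \<tau>}"
    then obtain a b c where \<tau>: "\<tau> = (a, b, c)" "0 \<le> a" "a < n" "a < b" "b < c" "c \<le> a + n"
      "edge a b \<in> T" "edge b c \<in> T" "edge a c \<in> T"
      and us: "edge a b \<in> orbit x (x + n) \<or> edge b c \<in> orbit x (x + n) \<or> edge a c \<in> orbit x (x + n)"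
      by (auto simp: tris_def uses_def)
    have "\<exists>k. a + k * n = x \<and> c + k * n = x + n"
      using us
    proof (elim disjE)
      assume "edge a b \<in> orbit x (x + n)"
      then obtain k where "a + k * n = x" "b + k * n = x + n"
        using orbit_lift[of a b x "x + n"] \<tau> n_pos by auto
      then show ?thesis using \<tau> by linarith
    next
      assume "edge b c \<in> orbit x (x + n)"
      then obtain k where "b + k * n = x" "c + k * n = x + n"
        using orbit_lift[of b c x "x + n"] \<tau> n_pos by auto
      then show ?thesis using \<tau> by linarith
    next
      assume "edge a c \<in> orbit x (x + n)"
      then show ?thesis using orbit_lift[of a c x "x + n"] \<tau> n_pos by auto
    qed
    then obtain k where k: "a + k * n = x" "c + k * n = x + n" by blast
    have sh: "edge (a + k * n) (b + k * n) \<in> T" "edge (b + k * n) (c + k * n) \<in> T"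
      using \<tau> good_shift[OF T] by blast+
    have "b + k * n = u"
      by (rule inner_apex_unique[OF T, of x _ "x + n"])
        (use k sh \<tau> assms n_pos in auto)
    moreover have "\<tau> = norm3 (a + k * n, b + k * n, c + k * n)"
      unfolding norm3_shift using \<tau> by (simp add: norm3_id)
    ultimately show "\<tau> \<in> {norm3 (x, u, x + n)}" using k by simp
  next
    fix \<tau> assume "\<tau> \<in> {norm3 (x, u, x + n)}"
    moreover have "norm3 (x, u, x + n) \<in> tris T" by (rule norm3_mem_tris) (use assms in auto)
    moreover have "uses (orbit x (x + n)) (norm3 (x, u, x + n))"
      unfolding uses_norm3 by (simp add: uses_def orbit_def)
    ultimately show "\<tau> \<in> {\<tau> \<in> tris T. uses (orbit x (x + n)) \<tau>}" by simp
  qed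
  then show ?thesis using Phi_Diff[of w T "orbit x (x + n)"] by simp
qed

text \<open>The first expression is the simplicial coboundary of \<open>w\<close> on a quadrilateral
  within a half turn; the second clause treats flips of diameters.\<close>

definition cocycle_bounded :: "int \<Rightarrow> (int \<times> int \<times> int \<Rightarrow> int) \<Rightarrow> bool" where
  "cocycle_bounded K w \<longleftrightarrow>
    (\<forall>a b c e. a < b \<longrightarrow> b < c \<longrightarrow> c < e \<longrightarrow> e \<le> a + n \<longrightarrow>
      \<bar>w (norm3 (a, b, e)) + w (norm3 (b, c, e)) - w (norm3 (a, b, c)) - w (norm3 (a, c, e))\<bar> \<le> K) \<and>
    (\<forall>a b. a < b \<longrightarrow> b < a + n \<longrightarrow> \<bar>w (norm3 (b, a + n, b + n)) - w (norm3 (a, b, a + n))\<bar> \<le> K)"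

lemma Phi_change_quad:
  assumes K: "cocycle_bounded K w" and T: "good T" "good T'" "T - orbit a c = T' - orbit b e"
    and ord: "a < b" "b < c" "c < e" "e \<le> a + n"
    and diag: "edge a c \<in> T" "edge b e \<in> T'"
    and sides: "{edge a b, edge b c, edge c e, edge e a} \<subseteq> T" "{edge a b, edge b c, edge c e, edge e a} \<subseteq> T'"
  shows "\<bar>Phi w T' - Phi w T\<bar> \<le> K"
proof -
  have "Phi w T = Phi w (T - orbit a c) + w (norm3 (a, b, c)) + w (norm3 (a, c, e))"
    by (rule Phi_edge[OF T(1), where v = e]) (use ord diag sides n_pos in auto)
  moreover have "Phi w T' = Phi w (T' - orbit b e) + w (norm3 (b, c, e)) + w (norm3 (a, b, e))"
    by (rule Phi_edge[OF T(2), where v = "a + 2 * n"]) (use ord diag sides n_pos in auto)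
  ultimately show ?thesis using K T(3) ord unfolding cocycle_bounded_def by (smt (verit))
qed

text \<open>A triangle around the centre crosses its own antipode: the image of side
  \<open>zx\<close>, from \<open>z - n\<close> to \<open>x + n\<close>, crosses
  \<open>xy\<close>.\<close>

lemma no_central_triangle:
  assumes T: "good T" and "x < y" "y < z" "z < x + 2 * n"
    and E: "edge x y \<in> T" "edge y z \<in> T" "edge z x \<in> T"
    and gaps: "y < x + n" "z < y + n" "x + n < z"
  shows False
proof (rule good_noncrossing[OF T, of x "z - n" y "x + n"])
  have "edge (z + (-1) * n) (x + 2 * n + (-1) * n) \<in> T" by (rule good_shift[OF T]) (use E in simp)
  then show "edge (z - n) (x + n) \<in> T" by (simp add: add.commute)
qed (use assms n_pos in auto)

lemma Phi_change_flip:
  assumes K: "cocycle_bounded K w" and cs: "cs_triangulation d p T" "cs_triangulation d p T'"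
    and "flip d p T T'"
  shows "\<bar>Phi w T' - Phi w T\<bar> \<le> K"
proof -
  have good: "good T" "good T'" using cs good_if_cs_triangulation by blast+
  obtain x x' y y' where f: "{x, x'} \<in> T" "{{x, y}, {y, x'}, {x', y'}, {y', x}} \<subseteq> T"
    "crossing p {x, x'} {y, y'}"
    "T' = T - {{x, x'}, {opposite d x, opposite d x'}} \<union> {{y, y'}, {opposite d y, opposite d y'}}"
    using \<open>flip d p T T'\<close> unfolding flip_def by blast
  have sub: "T \<subseteq> edges (2 * d + 2)" "T' \<subseteq> edges (2 * d + 2)" using good unfolding good_def by simp_all
  then have "{x, x'} \<in> edges (2 * d + 2)" "{y, y'} \<in> edges (2 * d + 2)" using f by auto
  from f(3) this obtain a b c e where ord: "a < b" "b < c" "c < e" "e < a + 2 * n"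
    and ac: "{x, x'} = edge a c" and be: "{y, y'} = edge b e"
    by (rule crossing_lift)
  have op: "{opposite d u, opposite d v} = edge (i + n) (j + n)" if "{u, v} = edge i j" for u v i j
    using opposite_edge[of i j] unfolding that[symmetric] by simp
  have R: "{{x, x'}, {opposite d x, opposite d x'}} = orbit a c"
    "{{y, y'}, {opposite d y, opposite d y'}} = orbit b e"
    using ac be op[OF ac] op[OF be] by (simp_all add: orbit_def)
  have T': "T' = T - orbit a c \<union> orbit b e" using f(4) unfolding R by simp
  have diag: "edge a c \<in> T" "edge b e \<in> T'" using f(1) ac unfolding T' by (auto simp: orbit_def)
  have sides: "edge a b \<in> T" "edge b c \<in> T" "edge c e \<in> T" "edge e a \<in> T"
    using f(2) ac be unfolding edge_def by (auto simp: doubleton_eq_iff insert_commute)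
  have ne: "vert a \<noteq> vert b" "vert a \<noteq> vert c" "vert a \<noteq> vert e" "vert b \<noteq> vert c"
    "vert b \<noteq> vert e" "vert c \<noteq> vert e"
    using vert_eq_imp[of a b] vert_eq_imp[of a c] vert_eq_imp[of a e] vert_eq_imp[of b c]
      vert_eq_imp[of b e] vert_eq_imp[of c e] ord by auto
  have "edge a b \<notin> orbit a c" "edge b c \<notin> orbit a c" "edge c e \<notin> orbit a c" "edge e a \<notin> orbit a c"
    using adjacent_notin_orbit[of a b c] adjacent_notin_orbit[of c b a]
      adjacent_notin_orbit[of c e a] adjacent_notin_orbit[of a e c] ne
    by (metis edge_commute orbit_commute)+
  then have sides': "edge a b \<in> T'" "edge b c \<in> T'" "edge c e \<in> T'" "edge e a \<in> T'"
    using sides unfolding T' by auto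
  have "edge b e \<notin> T" using good_noncrossing[OF good(1)] ord diag(1) by blast
  then have "F \<notin> T" if F: "F \<in> orbit b e" for F
  proof -
    have "edge (b + n) (e + n) \<notin> T"
    proof
      assume "edge (b + n) (e + n) \<in> T"
      then have "edge (b + n + (-1) * n) (e + n + (-1) * n) \<in> T" by (rule good_shift[OF good(1)])
      then show False using \<open>edge b e \<notin> T\<close> by simp
    qed
    then show ?thesis using that \<open>edge b e \<notin> T\<close> by (auto simp: orbit_def)
  qed
  then have D: "T - orbit a c = T' - orbit b e" unfolding T' by blast
  note change = Phi_change_quad[OF K]
  \<comment> \<open>The first four cases place the quadrilateral in a half turn starting at
    \<open>a\<close>, \<open>c\<close>, \<open>e\<close> or \<open>b\<close>. Starting at
    \<open>e\<close> or \<open>b\<close> exchanges the diagonals, so there \<open>T\<close> and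
    \<open>T'\<close> trade roles. Otherwise the centre lies inside and both diagonals are
    diameters.\<close>
  consider "b + n \<le> a + 2 * n \<and> e \<le> a + n" | "b + n \<le> c" | "c + n \<le> e" | "a + n \<le> b" | "c = a + n" "e = b + n"
  proof (cases "c = a + n")
    case True
    \<comment> \<open>The antipode of triangle \<open>cea\<close> lies on the same side of the
      diameter \<open>ac\<close> as \<open>b\<close>, so its apex is \<open>b\<close>.\<close>
    have "edge (e - n) (a - n) \<in> T" using good_shift[OF good(1) sides(4), of "- 1"] by simp
    moreover have "a - n + 2 * n = a + n" by simp
    ultimately have "edge (e - n) (a + n) \<in> T" using edge_period(2)[of "e - n" "a - n"] by metis
    moreover have "edge a (e - n) \<in> T"
      using good_shift[OF good(1) sides(3), of "- 1"] True by simp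
    ultimately have "e - n = b" using True ord sides
      by (intro inner_apex_unique[OF good(1), of a _ "a + n"]) auto
    then show ?thesis using that True by simp
  next
    case False
    show ?thesis
    proof (rule ccontr)
      assume neg: "\<not> thesis"
      then have gaps: "b < a + n" "c < b + n" "e < c + n" "a + n < e"
        using that ord by linarith+
      show False
      proof (cases "c < a + n")
        case True
        then show False using no_central_triangle[OF good(1), of a c e] sides diag gaps ord by simp
      next
        case 2: False
        then show False using no_central_triangle[OF good(1), of a b c] sides diag gaps ord False
          by (simp add: edge_commute)
      qed
    qed
  qed
  then show ?thesis
  proof cases
    case 1
    then show ?thesis using change[OF good D] ord sides sides' diag by simp
  next
    case 2
    have "\<bar>Phi w T' - Phi w T\<bar> \<le> K"
      by (rule change[OF good, of c "a + 2 * n" e "b + 2 * n"])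
        (use 2 D ord sides sides' diag in \<open>auto simp: edge_commute orbit_commute\<close>)
    then show ?thesis .
  next
    case 3
    have "\<bar>Phi w T - Phi w T'\<bar> \<le> K"
      by (rule change[OF good(2,1), of "e - 2 * n" b a c])
        (use 3 D ord sides sides' diag in \<open>auto simp: edge_commute orbit_commute\<close>)
    then show ?thesis by (simp add: abs_minus_commute)
  next
    case 4
    have "\<bar>Phi w T - Phi w T'\<bar> \<le> K"
      by (rule change[OF good(2,1), of b e c "a + 2 * n"])
        (use 4 D ord sides sides' diag in \<open>auto simp: edge_commute orbit_commute\<close>)
    then show ?thesis by (simp add: abs_minus_commute)
  next
    case 5
    have "edge (b + n) (a + n + n) \<in> T'" using sides' 5 by (simp add: add.assoc)
    have "Phi w T = Phi w (T - orbit a c) + w (norm3 (a, b, a + n))"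
      unfolding 5(1) by (rule Phi_diameter[OF good(1)]) (use 5 ord sides diag in auto)
    moreover have "Phi w T' = Phi w (T' - orbit b e) + w (norm3 (b, a + n, b + n))"
      unfolding 5(2) by (rule Phi_diameter[OF good(2)]) (use 5 ord sides' diag in auto)
    ultimately show ?thesis using K D ord 5 unfolding cocycle_bounded_def by auto
  qed
qed

lemma Phi_le_flips:
  assumes K: "cocycle_bounded K w" and "cs_triangulation d p T'" "(flip d p ^^ k) T T'"
  shows "\<bar>Phi w T' - Phi w T\<bar> \<le> K * int k"
  using assms(3)
proof (induction k arbitrary: T)
  case (Suc k)
  then obtain S where S: "flip d p T S" "(flip d p ^^ k) S T'" by (elim relpowp_Suc_E2)
  have "cs_triangulation d p T" using S(1) by (simp add: flip_def)
  \<comment> \<open>\<open>S\<close> is either the source of another flip, where \<open>flip\<close>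
    supplies the claim, or the target \<open>T'\<close>.\<close>
  moreover have "cs_triangulation d p S"
  proof (cases k)
    case 0
    then show ?thesis using S(2) assms(2) by simp
  next
    case (Suc j)
    then show ?thesis using S(2) by (metis flip_def relpowp_Suc_E2)
  qed
  ultimately have "\<bar>Phi w S - Phi w T\<bar> \<le> K" using Phi_change_flip[OF K] S(1) by blast
  then show ?case using Suc.IH[OF S(2)] by (simp add: algebra_simps)
qed simp

end

section \<open>Caterpillar triangulations\<close>

text \<open>Encodes a triangulation of the half polygon on one side of a diameter whose triangles
  form a path: each letter cuts off one boundary edge at the left or right end.\<close>

fun intervals :: "int \<Rightarrow> int \<Rightarrow> bool list \<Rightarrow> (int \<times> int) set" where
  "intervals a b [] = {(a, b)}"
| "intervals a b (s # ss) =
    insert (a, b) (if s then intervals (a + 1) b ss else intervals a (b - 1) ss)"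

fun triangles :: "int \<Rightarrow> int \<Rightarrow> bool list \<Rightarrow> (int \<times> int \<times> int) list" where
  "triangles a b [] = []"
| "triangles a b (s # ss) =
    (if s then (a, a + 1, b) # triangles (a + 1) b ss else (a, b - 1, b) # triangles a (b - 1) ss)"

lemma intervals_bounds:
  "(x, y) \<in> intervals a b ss \<Longrightarrow> b - a = 1 + int (length ss) \<Longrightarrow> a \<le> x \<and> x < y \<and> y \<le> b"
  by (induction ss arbitrary: a b) (fastforce split: if_splits)+

lemma intervals_top: "(a, b) \<in> intervals a b ss"
  by (cases ss) auto

lemma intervals_chain:
  assumes "(x, y) \<in> intervals a b ss" "(x', y') \<in> intervals a b ss" "b - a = 1 + int (length ss)"
  shows "x \<le> x' \<and> y' \<le> y \<or> x' \<le> x \<and> y \<le> y'"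
  using assms
proof (induction ss arbitrary: a b)
  case (Cons s ss)
  have bd: "a \<le> u \<and> v \<le> b" if "(u, v) \<in> intervals a b (s # ss)" for u v
    using intervals_bounds[OF that] Cons.prems(3) by simp
  show ?case
  proof (cases "(x, y) = (a, b) \<or> (x', y') = (a, b)")
    case True
    then show ?thesis using bd Cons.prems(1,2) by blast
  next
    case False
    show ?thesis
    proof (cases s)
      case True
      then show ?thesis using Cons.IH[of "a + 1" b] Cons.prems False by auto
    next
      case s: False
      then show ?thesis using Cons.IH[of a "b - 1"] Cons.prems False by auto
    qed
  qed
qed simp

lemma intervals_next:
  assumes "(x, y) \<in> intervals a b ss" "x + 1 < y" "b - a = 1 + int (length ss)"
  shows "(x + 1, y) \<in> intervals a b ss \<and> (x, x + 1, y) \<in> set (triangles a b ss)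
    \<or> (x, y - 1) \<in> intervals a b ss \<and> (x, y - 1, y) \<in> set (triangles a b ss)"
  using assms
proof (induction ss arbitrary: a b)
  case (Cons s ss)
  show ?case
  proof (cases "(x, y) = (a, b)")
    case True
    then show ?thesis using intervals_top by auto
  next
    case False
    show ?thesis
    proof (cases s)
      case True
      then show ?thesis using Cons.IH[of "a + 1" b] Cons.prems False by auto
    next
      case s: False
      then show ?thesis using Cons.IH[of a "b - 1"] Cons.prems False by auto
    qed
  qed
qed auto

lemma triangles_intervals:
  "(x, u, y) \<in> set (triangles a b ss) \<Longrightarrow> b - a = 1 + int (length ss) \<Longrightarrow>
    (x, y) \<in> intervals a b ss \<and> x < u \<and> u < y \<and>
    (u = x + 1 \<and> (x + 1, y) \<in> intervals a b ss \<or> u = y - 1 \<and> (x, y - 1) \<in> intervals a b ss)"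
proof (induction ss arbitrary: a b)
  case (Cons s ss)
  show ?case
  proof (cases s)
    case True
    then show ?thesis
      using Cons.IH[of "a + 1" b] Cons.prems intervals_top[of "a + 1" b ss] by auto
  next
    case False
    then show ?thesis
      using Cons.IH[of a "b - 1"] Cons.prems intervals_top[of a "b - 1" ss] by auto
  qed
qed simp

text \<open>Spans decrease strictly along the word and are invariant under translation, so the
  triangles stay distinct modulo central symmetry.\<close>

lemma triangles_distinct_gaps:
  "b - a = 1 + int (length ss) \<Longrightarrow> distinct (map (\<lambda>(x, u, y). y - x) (triangles a b ss))"
proof (induction ss arbitrary: a b)
  case (Cons s ss)
  have gap: "y - x < b - a" if "(x, u, y) \<in> set (if s then triangles (a + 1) b ss else triangles a (b - 1) ss)" for x u y
  proof (cases s)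
    case True
    then show ?thesis
      using that triangles_intervals[of x u y "a + 1" b ss] intervals_bounds[of x y "a + 1" b ss] Cons.prems by auto
  next
    case False
    then show ?thesis
      using that triangles_intervals[of x u y a "b - 1" ss] intervals_bounds[of x y a "b - 1" ss] Cons.prems by auto
  qed
  have "b - a \<notin> (\<lambda>(x, u, y). y - x) `
      set (if s then triangles (a + 1) b ss else triangles a (b - 1) ss)"
  proof (rule notI, erule imageE)
    fix \<tau> assume \<tau>: "b - a = (case \<tau> of (x, u, y) \<Rightarrow> y - x)"
      "\<tau> \<in> set (if s then triangles (a + 1) b ss else triangles a (b - 1) ss)"
    obtain x u y where "\<tau> = (x, u, y)" by (cases \<tau>)
    then show False using gap[of x u y] \<tau> by simp
  qed
  then show ?case
    using Cons.IH[where a = "a + 1" and b = b] Cons.IH[where a = a and b = "b - 1"] Cons.prems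
    by (cases s) simp_all
qed simp

text \<open>This yields maximality. A missing chord that ends at the vertex just cut off crosses the
  next interval; any other chord is left to the rest of the word.\<close>

lemma intervals_interleave:
  assumes "(x, y) \<notin> intervals a b ss" "a \<le> x" "x + 1 < y" "y \<le> b" "b - a = 1 + int (length ss)"
  shows "\<exists>(u, v) \<in> intervals a b ss. x < u \<and> u < y \<and> y < v \<or> u < x \<and> x < v \<and> v < y"
  using assms
proof (induction ss arbitrary: a b)
  case (Cons s ss)
  show ?case
  proof (cases s)
    case True
    show ?thesis
    proof (cases "a + 1 \<le> x")
      case x: True
      then show ?thesis using Cons.IH[of "a + 1" b] Cons.prems True by auto
    next
      case False
      then have "x = a" "y < b" using Cons.prems True by auto
      then show ?thesis using intervals_top[of "a + 1" b ss] Cons.prems True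
        by (intro bexI[of _ "(a + 1, b)"]) auto
    qed
  next
    case s: False
    show ?thesis
    proof (cases "y \<le> b - 1")
      case y: True
      then show ?thesis using Cons.IH[of a "b - 1"] Cons.prems s by auto
    next
      case False
      then have "y = b" "a < x" using Cons.prems s by auto
      then show ?thesis using intervals_top[of a "b - 1" ss] Cons.prems s
        by (intro bexI[of _ "(a, b - 1)"]) auto
    qed
  qed
qed simp

section \<open>Caterpillars as centrally symmetric triangulations\<close>

context cs_polygon begin

definition caterpillar :: "int \<Rightarrow> bool list \<Rightarrow> nat set set" where
  "caterpillar a ss = {edge x (x + 1) | x. True}
     \<union> {edge (x + k * n) (y + k * n) | x y k. (x, y) \<in> intervals a (a + n) ss}"

context
  fixes st :: int and ss :: "bool list"
  assumes len: "n = 1 + int (length ss)"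
begin

lemma iv_bounds: "(x, y) \<in> intervals st (st + n) ss \<Longrightarrow> st \<le> x \<and> x < y \<and> y \<le> st + n"
  using intervals_bounds len by simp

lemma caterpillar_cases:
  assumes "edge u v \<in> caterpillar st ss" "u < v" "v \<le> u + n"
  shows "v = u + 1 \<or> (\<exists>x y k. (x, y) \<in> intervals st (st + n) ss \<and> u = x + k * n \<and> v = y + k * n)"
proof -
  have "(\<exists>x. edge u v = edge x (x + 1)) \<or>
    (\<exists>x y k. (x, y) \<in> intervals st (st + n) ss \<and> edge u v = edge (x + k * n) (y + k * n))"
    using assms(1) unfolding caterpillar_def by blast
  then show ?thesis
  proof (elim disjE exE conjE)
    fix x assume "edge u v = edge x (x + 1)"
    then obtain j where "u + j * n = x" "v + j * n = x + 1"
      using orbit_lift[of u v x "x + 1"] assms n_pos by (auto simp: orbit_def)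
    then show ?thesis by simp
  next
    fix x y k assume xy: "(x, y) \<in> intervals st (st + n) ss" "edge u v = edge (x + k * n) (y + k * n)"
    then obtain j where "u + j * n = x + k * n" "v + j * n = y + k * n"
      using orbit_lift[of u v "x + k * n" "y + k * n"] assms n_pos iv_bounds[OF xy(1)]
      by (auto simp: orbit_def)
    then have "u = x + (k - j) * n" "v = y + (k - j) * n" by (simp_all add: algebra_simps)
    then show ?thesis using xy(1) by blast
  qed
qed

lemma caterpillar_noncrossing_short:
  assumes "edge a c \<in> caterpillar st ss" "edge b e \<in> caterpillar st ss"
    and "a < b" "b < c" "c < e" "c \<le> a + n" "e \<le> b + n"
  shows False
proof -
  obtain x y k where xy: "(x, y) \<in> intervals st (st + n) ss" "a = x + k * n" "c = y + k * n"
    using caterpillar_cases[OF assms(1)] assms by auto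
  obtain u v j where uv: "(u, v) \<in> intervals st (st + n) ss" "b = u + j * n" "e = v + j * n"
    using caterpillar_cases[OF assms(2)] assms by auto
  have "j * n < (k + 1) * n" "k * n < (j + 1) * n"
    using assms xy uv iv_bounds[OF xy(1)] iv_bounds[OF uv(1)] by (simp_all add: algebra_simps)
  then have "j < k + 1" "k < j + 1" using n_pos by (simp_all only: mult_less_cancel_right_pos)
  then have "j = k" by simp
  then show False using intervals_chain[OF xy(1) uv(1)] len assms xy uv by simp
qed

lemma good_caterpillar: "good (caterpillar st ss)"
  unfolding good_def
proof (intro conjI allI impI)
  have E: "edge x y \<in> edges (2 * d + 2)" if "x < y" "y \<le> x + n" for x y
  proof -
    have "vert x \<noteq> vert y" using vert_eq_imp[of x y] that n_pos by auto
    then show ?thesis unfolding edges_def edge_def using vert_less by blast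
  qed
  show "caterpillar st ss \<subseteq> edges (2 * d + 2)"
    unfolding caterpillar_def using E n_pos iv_bounds by fastforce
next
  fix x y assume "edge x y \<in> caterpillar st ss"
  then consider u where "edge x y = edge u (u + 1)"
    | u v k where "(u, v) \<in> intervals st (st + n) ss" "edge x y = edge (u + k * n) (v + k * n)"
    unfolding caterpillar_def by blast
  then show "edge (x + n) (y + n) \<in> caterpillar st ss"
  proof cases
    case 1
    then have "edge (x + n) (y + n) = edge (u + n) (u + n + 1)"
      by (metis opposite_edge add.commute add.left_commute)
    then show ?thesis unfolding caterpillar_def by blast
  next
    case 2
    have "edge (x + n) (y + n) = edge (u + (k + 1) * n) (v + (k + 1) * n)"
      using opposite_edge[of x y] opposite_edge[of "u + k * n" "v + k * n"] 2(2)
      by (simp add: algebra_simps)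
    then show ?thesis unfolding caterpillar_def using 2(1) by blast
  qed
next
  fix a b c e assume ord: "a < b" "b < c" "c < e" "e < a + 2 * n" and ac: "edge a c \<in> caterpillar st ss"
  show "edge b e \<notin> caterpillar st ss"
  proof
    assume be: "edge b e \<in> caterpillar st ss"
    note X = caterpillar_noncrossing_short
    have ac': "edge c (a + 2 * n) \<in> caterpillar st ss" "edge (a + 2 * n) (c + 2 * n) \<in> caterpillar st ss"
      and be': "edge e (b + 2 * n) \<in> caterpillar st ss"
      using ac be by (simp_all add: edge_commute)
    consider "c \<le> a + n" "e \<le> b + n" | "c \<le> a + n" "b + n < e" | "a + n < c" "e \<le> b + n" | "a + n < c" "b + n < e"
      by linarith
    then show False
    proof cases
      case 1
      then show ?thesis using X[OF ac be] ord by simp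
    next
      case 2
      then show ?thesis using X[OF be' ac'(2)] ord by simp
    next
      case 3
      then show ?thesis using X[OF be ac'(1)] ord by simp
    next
      case 4
      then show ?thesis using X[OF ac'(1) be'] ord by simp
    qed
  qed
qed

lemma cs_triangulation_caterpillar: "cs_triangulation d p (caterpillar st ss)"
proof (rule cs_triangulation_if_good[OF good_caterpillar])
  have short: "\<exists>F \<in> caterpillar st ss. crossing p F (edge x y)"
    if xy: "x < y" "y \<le> x + n" "edge x y \<notin> caterpillar st ss" for x y
  proof -
    have "y \<noteq> x + 1" using xy(3) by (auto simp: caterpillar_def)
    then have gap: "x + 1 < y" using xy by simp
    define k where "k = (x - st) div n"
    have k: "st \<le> x - k * n" "x - k * n < st + n"
      using pos_mod_sign[OF n_pos, of "x - st"] pos_mod_bound[OF n_pos, of "x - st"]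
        minus_div_mult_eq_mod[of "x - st" n] unfolding k_def by linarith+
    have iv: "edge (u + k * n) (v + k * n) \<in> caterpillar st ss"
      if "(u, v) \<in> intervals st (st + n) ss" for u v
      using that unfolding caterpillar_def by blast
    show ?thesis
    proof (cases "y - k * n \<le> st + n")
      case True
      have "(x - k * n, y - k * n) \<notin> intervals st (st + n) ss" using iv[of "x - k * n" "y - k * n"] xy(3) by auto
      then obtain u v where uv: "(u, v) \<in> intervals st (st + n) ss"
        "x - k * n < u \<and> u < y - k * n \<and> y - k * n < v \<or> u < x - k * n \<and> x - k * n < v \<and> v < y - k * n"
        using intervals_interleave[of "x - k * n" "y - k * n" st "st + n" ss] k True gap len by auto
      from uv(2) have "crossing p (edge (u + k * n) (v + k * n)) (edge x y)"
      proof (elim disjE conjE)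
        assume "x - k * n < u" "u < y - k * n" "y - k * n < v"
        then show ?thesis using iv_bounds[OF uv(1)] k n_pos
          by (intro crossing_sym[OF edge_crossing]) auto
      next
        assume "u < x - k * n" "x - k * n < v" "v < y - k * n"
        then show ?thesis using iv_bounds[OF uv(1)] k True n_pos by (intro edge_crossing) auto
      qed
      then show ?thesis using iv[OF uv(1)] by blast
    next
      case False
      \<comment> \<open>A chord leaving the half turn that starts at \<open>st + k * n\<close>
        crosses the diameter bounding it.\<close>
      have "crossing p (edge (st + k * n) (st + n + k * n)) (edge x y)"
        by (rule edge_crossing) (use False k xy in linarith)+
      then show ?thesis using iv[OF intervals_top] by blast
    qed
  qed
  fix x y assume xy: "x < y" "y < x + 2 * n" "edge x y \<notin> caterpillar st ss"
  show "\<exists>F \<in> caterpillar st ss. crossing p F (edge x y)"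
  proof (cases "y \<le> x + n")
    case True
    then show ?thesis using short xy by blast
  next
    case False
    then show ?thesis using short[of y "x + 2 * n"] xy by (simp add: edge_commute)
  qed
qed

lemma triangle_edges:
  assumes "(x, u, y) \<in> set (triangles st (st + n) ss)"
  shows "edge x u \<in> caterpillar st ss" "edge u y \<in> caterpillar st ss" "edge x y \<in> caterpillar st ss"
    "x < u" "u < y" "y \<le> x + n"
proof -
  have iv: "edge u v \<in> caterpillar st ss" if "(u, v) \<in> intervals st (st + n) ss" for u v
  proof -
    have "edge (u + 0 * n) (v + 0 * n) \<in> caterpillar st ss" using that unfolding caterpillar_def by blast
    then show ?thesis by simp
  qed
  have bd: "edge z (z + 1) \<in> caterpillar st ss" for z unfolding caterpillar_def by blast
  have *: "(x, y) \<in> intervals st (st + n) ss" "x < u" "u < y"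
    "u = x + 1 \<and> (x + 1, y) \<in> intervals st (st + n) ss \<or> u = y - 1 \<and> (x, y - 1) \<in> intervals st (st + n) ss"
    using triangles_intervals[OF assms] len by auto
  show "x < u" "u < y" "y \<le> x + n" "edge x y \<in> caterpillar st ss" using * iv iv_bounds[OF *(1)] by auto
  show "edge x u \<in> caterpillar st ss" "edge u y \<in> caterpillar st ss"
    using *(4) iv bd[of x] bd[of "y - 1"] by auto
qed

lemma tris_caterpillar: "tris (caterpillar st ss) = norm3 ` set (triangles st (st + n) ss)"
proof (intro equalityI subsetI)
  fix \<tau> assume "\<tau> \<in> tris (caterpillar st ss)"
  then obtain a b c where \<tau>: "\<tau> = (a, b, c)" "0 \<le> a" "a < n" "a < b" "b < c" "c \<le> a + n"
    "edge a b \<in> caterpillar st ss" "edge b c \<in> caterpillar st ss" "edge a c \<in> caterpillar st ss"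
    by (auto simp: tris_def)
  obtain x y k where xy: "(x, y) \<in> intervals st (st + n) ss" "a = x + k * n" "c = y + k * n"
    using caterpillar_cases[OF \<tau>(9)] \<tau> by auto
  obtain u where u: "(x, u, y) \<in> set (triangles st (st + n) ss)"
    using intervals_next[OF xy(1)] xy \<tau> len by auto
  have "b = u + k * n"
    by (rule inner_apex_unique[OF good_caterpillar, of a b c])
      (use \<tau> xy triangle_edges[OF u] good_shift[OF good_caterpillar] n_pos in auto)
  then have "\<tau> = norm3 (x, u, y)" using \<tau> xy norm3_shift[of x k u y] norm3_id[of a b c] by simp
  then show "\<tau> \<in> norm3 ` set (triangles st (st + n) ss)" using u by blast
next
  fix \<tau> assume "\<tau> \<in> norm3 ` set (triangles st (st + n) ss)"
  then obtain x u y where xuy: "(x, u, y) \<in> set (triangles st (st + n) ss)" "\<tau> = norm3 (x, u, y)"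
    by auto
  then show "\<tau> \<in> tris (caterpillar st ss)"
    using norm3_mem_tris[OF good_caterpillar triangle_edges(1,2,3)[OF xuy(1)] triangle_edges(4,5,6)[OF xuy(1)]] xuy(2) by simp
qed

lemma Phi_caterpillar:
  "Phi w (caterpillar st ss) = sum_list (map (\<lambda>\<tau>. w (norm3 \<tau>)) (triangles st (st + n) ss))"
proof -
  let ?L = "triangles st (st + n) ss" and ?g = "\<lambda>(x, u, y). y - x :: int"
  have D: "distinct (map ?g ?L)" by (rule triangles_distinct_gaps) (use len in simp)
  have "inj_on norm3 (set ?L)"
  proof (rule inj_onI)
    fix \<sigma> \<tau> assume "\<sigma> \<in> set ?L" "\<tau> \<in> set ?L" "norm3 \<sigma> = norm3 \<tau>"
    moreover have "?g \<sigma> = ?g \<tau>"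
    proof -
      obtain a b c a' b' c' where "\<sigma> = (a, b, c)" "\<tau> = (a', b', c')" by (metis prod.exhaust)
      then show ?thesis using norm3_gap[of a b c a' b' c'] \<open>norm3 \<sigma> = norm3 \<tau>\<close> by simp
    qed
    ultimately show "\<sigma> = \<tau>" using D unfolding distinct_map by (auto dest: inj_onD)
  qed
  then show ?thesis
    using D unfolding Phi_def tris_caterpillar
    by (simp add: sum.reindex sum_list_distinct_conv_sum_set distinct_map)
qed

end
end

section \<open>The potentials of the two zigzags\<close>

locale cs_polygon_weight = cs_polygon d p n + weight n m s
  for d :: nat and p :: "nat \<Rightarrow> complex" and n m s :: int
begin

lemma cocycle_bounded_w: "cocycle_bounded (2 * N) w"
  unfolding cocycle_bounded_def
proof (intro conjI allI impI)
  have low: "norm3 (x, y, z) = (x, y, z)" if "0 \<le> x" "x < n" for x y z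
    using that by (rule norm3_id)
  have high: "norm3 (x, y, z) = (x - n, y - n, z - n)" if "n \<le> x" "x < 2 * n" for x y z
    using norm3_shift[of x "- 1" y z] norm3_id[of "x - n" "y - n" "z - n"] that by simp
  define k where "k a = - (a div n)" for a :: int
  have k: "0 \<le> a + k a * n" "a + k a * n < n" for a
    using pos_mod_sign[OF n_pos, of a] pos_mod_bound[OF n_pos, of a] minus_div_mult_eq_mod[of a n]
    unfolding k_def by linarith+
  show "\<bar>w (norm3 (a, b, e)) + w (norm3 (b, c, e)) - w (norm3 (a, b, c)) - w (norm3 (a, c, e))\<bar> \<le> 2 * N"
    if ord: "a < b" "b < c" "c < e" "e \<le> a + n" for a b c e
  proof -
    define a' b' c' e' where "a' = a + k a * n" and "b' = b + k a * n" and "c' = c + k a * n" and "e' = e + k a * n"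
    have o: "0 \<le> a'" "a' < n" "a' < b'" "b' < c'" "c' < e'" "e' \<le> a' + n"
      using k[of a] ord by (simp_all add: a'_def b'_def c'_def e'_def)
    have "\<bar>w (norm3 (a', b', e')) + w (norm3 (b', c', e')) - w (norm3 (a', b', c')) - w (norm3 (a', c', e'))\<bar> \<le> 2 * N"
    proof (cases "b' < n")
      case True
      then show ?thesis using cocycle_low_L[of a' b' c' e'] cocycle_low_R[of a' b' c' e'] o low
        by (cases "a' < m") simp_all
    next
      case False
      then show ?thesis using cocycle_high[of a' b' c' e'] o low high[of b'] by simp
    qed
    then show ?thesis unfolding a'_def b'_def c'_def e'_def norm3_shift .
  qed
  show "\<bar>w (norm3 (b, a + n, b + n)) - w (norm3 (a, b, a + n))\<bar> \<le> 2 * N"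
    if ord: "a < b" "b < a + n" for a b
  proof -
    define a' b' where "a' = a + k a * n" and "b' = b + k a * n"
    have o: "0 \<le> a'" "a' < n" "a' < b'" "b' < a' + n"
      using k[of a] ord by (simp_all add: a'_def b'_def)
    have "\<bar>w (norm3 (b', a' + n, b' + n)) - w (norm3 (a', b', a' + n))\<bar> \<le> 2 * N"
    proof (cases "b' < n")
      case True
      then show ?thesis using diameter_low[of a' b'] o low by simp
    next
      case False
      then show ?thesis using diameter_high[of a' b'] o low high[of b'] by simp
    qed
    moreover have "a' + n = a + n + k a * n" "b' + n = b + n + k a * n" by (simp_all add: a'_def b'_def)
    ultimately show ?thesis unfolding a'_def b'_def by (simp only: norm3_shift)
  qed
qed

end

section \<open>Sums of weights along a word\<close>

lemma triangles_append:
  "triangles a b (u @ v) = triangles a b u @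
    triangles (a + int (length (filter id u))) (b - int (length (filter Not u))) v"
  by (induction u arbitrary: a b) (auto simp: algebra_simps)

lemma length_filter_pairs [simp]:
  "length (filter id (concat (replicate k [True, False]))) = k"
  "length (filter Not (concat (replicate k [True, False]))) = k"
  "length (concat (replicate k [True, False])) = 2 * k"
  by (induction k) auto

context cs_polygon_weight begin

definition tsum :: "int \<Rightarrow> int \<Rightarrow> bool list \<Rightarrow> int" where
  "tsum a b ss = sum_list (map (\<lambda>\<tau>. w (norm3 \<tau>)) (triangles a b ss))"

lemma tsum_Nil [simp]: "tsum a b [] = 0"
  and tsum_True: "tsum a b (True # ss) = w (norm3 (a, a + 1, b)) + tsum (a + 1) b ss"
  and tsum_False: "tsum a b (False # ss) = w (norm3 (a, b - 1, b)) + tsum a (b - 1) ss"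
  by (simp_all add: tsum_def)

lemma tsum_append: "tsum a b (u @ v) = tsum a b u +
    tsum (a + int (length (filter id u))) (b - int (length (filter Not u))) v"
  by (simp add: tsum_def triangles_append)

lemma norm3_low: "0 \<le> x \<Longrightarrow> x < n \<Longrightarrow> norm3 (x, y, z) = (x, y, z)"
  by (rule norm3_id)

lemma D_step: "D l (l + 1) (l - s) = 4 * N - 2"
  unfolding D_def U_def by simp

lemma tsum_A_fan: "m + int j \<le> b \<Longrightarrow> b < n \<Longrightarrow> tsum 0 b (replicate j False) \<le> - int j * (N + 3)"
proof (induction j arbitrary: b)
  case (Suc j)
  have "R (b - n) \<le> R (- 1)" using Suc.prems by (intro R_mono) simp
  also have "\<dots> = N - 3" using s_ge by (simp add: R_def N_def)
  finally have "w (norm3 (0, b - 1, b)) \<le> - (N + 3)"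
    using Suc.prems m_pos by (simp add: norm3_low w_def algebra_simps)
  moreover have "tsum 0 (b - 1) (replicate j False) \<le> - int j * (N + 3)"
    using Suc.IH[of "b - 1"] Suc.prems by simp
  ultimately show ?case by (simp add: tsum_False algebra_simps)
qed simp

lemma tsum_A_zigzag: "\<lbrakk>0 \<le> a; b = n - s - a; a + int k < m; m + int k \<le> b\<rbrakk> \<Longrightarrow>
  tsum a b (concat (replicate k [True, False])) = - int k * (4 * N - 2)"
proof (induction k arbitrary: a b)
  case (Suc k)
  have "w (norm3 (a, a + 1, b)) = 2 - 2 * N"
    using Suc.prems m_less s_ge by (simp add: norm3_low w_def U_def)
  moreover have "w (norm3 (a + 1, b - 1, b)) = - 2 * N"
  proof -
    have "R (1 - s) = 0" by (simp add: R_def N_def)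
    then have "R (a + 1 - (n - b)) = 0" using Suc.prems(2) by simp
    then show ?thesis using Suc.prems m_less s_ge by (simp add: norm3_low w_def)
  qed
  moreover have "tsum (a + 1) (b - 1) (concat (replicate k [True, False])) = - int k * (4 * N - 2)"
    using Suc.IH[of "a + 1" "b - 1"] Suc.prems by simp
  ultimately show ?case by (simp add: tsum_True tsum_False algebra_simps)
qed simp

lemma tsum_A_bottom: "0 \<le> a \<Longrightarrow> a + int r < m \<Longrightarrow> tsum a m (replicate r True) \<le> 0"
proof (induction r arbitrary: a)
  case (Suc r)
  have "w (norm3 (a, a + 1, m)) \<le> 0"
    using Suc.prems m_less N_eq by (simp add: norm3_low w_def U_def)
  then show ?case using Suc.IH[of "a + 1"] Suc.prems by (simp add: tsum_True)
qed simp

lemma tsum_B_fan: "m < a \<Longrightarrow> a + int j < n \<Longrightarrow> tsum a (m + n) (replicate j True) = 2 * N * int j"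
proof (induction j arbitrary: a)
  case (Suc j)
  have "w (norm3 (a, a + 1, m + n)) = 2 * N"
    using Suc.prems m_pos by (simp add: norm3_low w_def)
  then show ?case using Suc.IH[of "a + 1"] Suc.prems by (simp add: tsum_True algebra_simps)
qed simp

lemma tsum_B_zigzag: "\<lbrakk>m \<le> a; a + int k < n; b - n = n - a + s; b < n + m; n + int k < b\<rbrakk> \<Longrightarrow>
  tsum a b (concat (replicate k [True, False])) = int k * (6 * N - 2)"
proof (induction k arbitrary: a b)
  case (Suc k)
  have "w (norm3 (a, a + 1, b)) = 2 * N"
  proof -
    have "R s = 2 * N" using s_ge by (simp add: R_def N_def)
    then have "R (b - n - (n - a)) = 2 * N" using Suc.prems(3) by simp
    then show ?thesis using Suc.prems m_pos by (simp add: norm3_low w_def)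
  qed
  moreover have "w (norm3 (a + 1, b - 1, b)) = 4 * N - 2"
  proof -
    have e: "b - n = b - 1 - n + 1" "n - (a + 1) = b - 1 - n - s" using Suc.prems(3) by simp_all
    have "D (b - 1 - n) (b - n) (n - (a + 1)) = 4 * N - 2"
      by (subst e(1), subst e(2)) (rule D_step)
    moreover have "w (a + 1, b - 1, b) = D (b - 1 - n) (b - n) (n - (a + 1))"
      using Suc.prems(1,2,4,5) m_pos unfolding w_def by simp
    moreover have "norm3 (a + 1, b - 1, b) = (a + 1, b - 1, b)"
      by (rule norm3_low) (use Suc.prems(1,2) m_pos in simp_all)
    ultimately show ?thesis by simp
  qed
  moreover have "tsum (a + 1) (b - 1) (concat (replicate k [True, False])) = int k * (6 * N - 2)"
    using Suc.IH[of "a + 1" "b - 1"] Suc.prems by simp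
  ultimately show ?case by (simp add: tsum_True tsum_False algebra_simps)
qed simp

lemma tsum_B_bottom: "b - n < m \<Longrightarrow> n + int j < b \<Longrightarrow>
  tsum n b (replicate j False) \<ge> 2 * N * int j - (if b - n \<ge> 3 then N else 0)"
proof (induction j arbitrary: b)
  case (Suc j)
  have "norm3 (n, b - 1, b) = (0, b - 1 - n, b - n)" using n_pos by (simp add: norm3_def)
  then have "w (norm3 (n, b - 1, b)) = t (b - 1 - n) 1"
    using Suc.prems m_pos by (simp add: w_def)
  then show ?case using Suc.IH[of "b - 1"] Suc.prems N_eq(2)
    by (auto simp: tsum_False t_def algebra_simps split: if_splits)
next
  case 0
  then show ?case using N_eq by simp
qed

definition word_A :: "bool list" where
  "word_A = False # replicate (nat (s - 1)) False @ concat (replicate (nat (n - m - s)) [True, False])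
    @ replicate (nat (2 * m - n + s - 1)) True"

definition word_B :: "bool list" where
  "word_B = True # replicate (nat (s + n - 2 * m)) True @ False #
    concat (replicate (nat (m - s - 2)) [True, False]) @ True # replicate (nat s) False"

context
  assumes m_ge: "s + 2 \<le> m" and nm: "m + s \<le> n" "n \<le> 2 * m" "2 * m \<le> n + s"
begin

lemma length_word_A: "n = 1 + int (length word_A)"
  using s_ge m_ge nm by (simp add: word_A_def)

lemma length_word_B: "n = 1 + int (length word_B)"
  using s_ge m_ge nm by (simp add: word_B_def)

lemma Phi_word_A:
  "Phi w (caterpillar 0 word_A) \<le> N - (s - 1) * (N + 3) - (n - m - s) * (4 * N - 2)"
proof -
  have "w (norm3 (0, n - 1, n)) \<le> N"
    using m_pos m_ge nm s_ge R_range(1)[of "- 1"] by (simp add: norm3_low w_def)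
  moreover have "tsum 0 (n - 1) (replicate (nat (s - 1)) False) \<le> - (s - 1) * (N + 3)"
    using tsum_A_fan[of "nat (s - 1)" "n - 1"] s_ge nm by simp
  moreover have "tsum 0 (n - s) (concat (replicate (nat (n - m - s)) [True, False]))
      = - (n - m - s) * (4 * N - 2)"
    using tsum_A_zigzag[of 0 "n - s" "nat (n - m - s)"] nm s_ge by simp
  moreover have "tsum (n - m - s) m (replicate (nat (2 * m - n + s - 1)) True) \<le> 0"
    using tsum_A_bottom[of "n - m - s" "nat (2 * m - n + s - 1)"] nm s_ge by simp
  moreover have "Phi w (caterpillar 0 word_A) = w (norm3 (0, n - 1, n))
    + (tsum 0 (n - 1) (replicate (nat (s - 1)) False)
    + (tsum 0 (n - s) (concat (replicate (nat (n - m - s)) [True, False]))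
    + tsum (n - m - s) m (replicate (nat (2 * m - n + s - 1)) True)))"
  proof -
    have "Phi w (caterpillar 0 word_A) = tsum 0 n word_A"
      by (simp add: Phi_caterpillar[OF length_word_A] tsum_def)
    also have "\<dots> = w (norm3 (0, n - 1, n))
      + (tsum 0 (n - 1) (replicate (nat (s - 1)) False)
      + (tsum 0 (n - s) (concat (replicate (nat (n - m - s)) [True, False]))
      + tsum (n - m - s) m (replicate (nat (2 * m - n + s - 1)) True)))"
      unfolding word_A_def tsum_False tsum_append using s_ge nm by simp
    finally show ?thesis .
  qed
  ultimately show ?thesis by (simp add: algebra_simps)
qed

lemma Phi_word_B:
  "Phi w (caterpillar m word_B)
    \<ge> N + (s + n - 2 * m) * (2 * N) + (m - s - 2) * (6 * N - 2) + 3 + (2 * s - 1) * N"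
proof -
  define a where "a = n - m + s + 1"
  have "w (norm3 (m, m + 1, m + n)) = N"
    using m_pos m_ge nm s_ge by (simp add: norm3_low w_def)
  moreover have "tsum (m + 1) (m + n) (replicate (nat (s + n - 2 * m)) True) = (s + n - 2 * m) * (2 * N)"
    using tsum_B_fan[of "m + 1" "nat (s + n - 2 * m)"] nm m_ge by simp
  moreover have "w (norm3 (a, m + n - 1, m + n)) \<ge> 0"
    using nm m_ge s_ge N_eq by (simp add: a_def norm3_low w_def K_def)
  moreover have "tsum a (m + n - 1) (concat (replicate (nat (m - s - 2)) [True, False]))
      = (m - s - 2) * (6 * N - 2)"
    using tsum_B_zigzag[of a "nat (m - s - 2)" "m + n - 1"] nm m_ge s_ge by (simp add: a_def)
  moreover have "w (norm3 (n - 1, n, n + s + 1)) = 3"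
    using nm m_ge s_ge by (simp add: norm3_low w_def D_def U_def R_def N_def)
  moreover have "tsum n (n + s + 1) (replicate (nat s) False) \<ge> (2 * s - 1) * N"
    using tsum_B_bottom[of "n + s + 1" "nat s"] m_ge s_ge by (simp add: algebra_simps)
  moreover have "Phi w (caterpillar m word_B) = w (norm3 (m, m + 1, m + n))
    + (tsum (m + 1) (m + n) (replicate (nat (s + n - 2 * m)) True)
    + (w (norm3 (a, m + n - 1, m + n))
    + (tsum a (m + n - 1) (concat (replicate (nat (m - s - 2)) [True, False]))
    + (w (norm3 (n - 1, n, n + s + 1)) + tsum n (n + s + 1) (replicate (nat s) False)))))"
  proof -
    have a: "m + 1 + (s + n - 2 * m) = a" "m + n - 1 - (m - s - 2) = n + s + 1"
      "a + (m - s - 2) = n - 1" "n - 1 + 1 = n"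
      by (simp_all add: a_def)
    have "Phi w (caterpillar m word_B) = tsum m (m + n) word_B"
      by (simp add: Phi_caterpillar[OF length_word_B] tsum_def)
    also have "\<dots> = w (norm3 (m, m + 1, m + n))
      + (tsum (m + 1) (m + n) (replicate (nat (s + n - 2 * m)) True)
      + (w (norm3 (m + 1 + (s + n - 2 * m), m + n - 1, m + n))
      + (tsum (m + 1 + (s + n - 2 * m)) (m + n - 1) (concat (replicate (nat (m - s - 2)) [True, False]))
      + (w (norm3 (m + 1 + (s + n - 2 * m) + (m - s - 2), m + 1 + (s + n - 2 * m) + (m - s - 2) + 1,
            m + n - 1 - (m - s - 2)))
        + tsum (m + 1 + (s + n - 2 * m) + (m - s - 2) + 1) (m + n - 1 - (m - s - 2)) (replicate (nat s) False)))))"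
      unfolding word_B_def tsum_True tsum_False tsum_append using s_ge nm m_ge
      by (simp add: tsum_True del: diff_diff_eq)
    finally show ?thesis unfolding a .
  qed
  ultimately show ?thesis by linarith
qed

lemma flips_ge:
  assumes "(flip d p ^^ k) (caterpillar 0 word_A) (caterpillar m word_B)"
  shows "(s + n - 2 * m) * (2 * N) + (m - s - 2) * (6 * N - 2) + 3 + (2 * s - 1) * N
    + (s - 1) * (N + 3) + (n - m - s) * (4 * N - 2) \<le> 2 * N * int k"
  using Phi_le_flips[OF cocycle_bounded_w cs_triangulation_caterpillar[OF length_word_B] assms]
    Phi_word_A Phi_word_B by (simp add: algebra_simps)

end
end

lemma final_estimate:
  fixes x N m s n k :: real
  assumes "2 \<le> x" "x \<le> N" "N \<le> x + 2" "N = 2 * s - 1" "n = x\<^sup>2 + 1" "n \<le> 2 * m" "2 * m \<le> n + 1"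
    and "(s + n - 2 * m) * (2 * N) + (m - s - 2) * (6 * N - 2) + 3 + (2 * s - 1) * N
      + (s - 1) * (N + 3) + (n - m - s) * (4 * N - 2) \<le> 2 * N * k"
  shows "5 * x\<^sup>2 / 2 - 4 * x - 4 \<le> k"
proof -
  define c where "c = N - x"
  have c: "N = x + c" "0 \<le> c" "c \<le> 2" using assms by (simp_all add: c_def)
  have s: "s = (N + 1) / 2" using assms by simp
  have "N * (2 * m - n) \<le> N * 1" using assms by (intro mult_left_mono) auto
  then have "5 * n * N - 2 * n - 5 / 2 * N\<^sup>2 - 13 * N - N + 15 / 2 \<le> 2 * N * k"
    using assms(8) unfolding s by (simp add: algebra_simps power2_eq_square divide_simps)
  moreover have "0 \<le> 8 * x * N - 2 * x\<^sup>2 - 5 / 2 * N\<^sup>2 - N + 11 / 2"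
  proof -
    have "8 * x * N - 2 * x\<^sup>2 - 5 / 2 * N\<^sup>2 - N + 11 / 2
        = 7 / 2 * (x * (x - 2)) + 6 * x + 3 * (x * c) + 5 / 2 * (c * (2 - c)) - 6 * c + 11 / 2"
      unfolding c(1) by (simp add: algebra_simps power2_eq_square)
    moreover have "0 \<le> x * (x - 2)" "0 \<le> x * c" "0 \<le> c * (2 - c)" using assms c by auto
    ultimately show ?thesis using c assms(1) by linarith
  qed
  ultimately have "2 * N * (5 * x\<^sup>2 / 2 - 4 * x - 4) \<le> 2 * N * k"
    unfolding assms(5) by (simp add: algebra_simps power2_eq_square)
  then show ?thesis using assms(1,2) by simp
qed

theorem theorem3:
  fixes d :: nat and p :: "nat \<Rightarrow> complex"
  assumes "d > 5"
    and "convex_polygon (2 * d + 2) p"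
  shows "\<exists>T T'. cs_triangulation d p T \<and> cs_triangulation d p T' \<and>
           ereal (5 * real d / 2 - 4 * sqrt (real d) - 4) \<le> ereal_of_enat (flip_distance d p T T')"
proof -
  define x where "x = sqrt (real d)"
  define n where "n = int d + 1"
  define m where "m = (n + 1) div 2"
  define s where "s = \<lceil>(x + 1) / 2\<rceil>"
  have x2: "x\<^sup>2 = real d" by (simp add: x_def)
  have x: "2 \<le> x" using assms(1) unfolding x_def by (intro real_le_rsqrt) simp
  have s: "x \<le> 2 * real_of_int s - 1" "2 * real_of_int s - 1 < x + 2"
  proof -
    have "real_of_int s - 1 < (x + 1) / 2" "(x + 1) / 2 \<le> real_of_int s"
      using ceiling_correct[of "(x + 1) / 2"] unfolding s_def by auto
    then show "x \<le> 2 * real_of_int s - 1" "2 * real_of_int s - 1 < x + 2"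
      by (simp_all add: field_simps)
  qed
  have s_ge: "2 \<le> s" using s(1) x by linarith
  have m: "n \<le> 2 * m" "2 * m \<le> n + 1" unfolding m_def by linarith+
  have m_ge: "s + 2 \<le> m"
  proof (cases "d \<ge> 9")
    case True
    then have "3 \<le> x" unfolding x_def by (intro real_le_rsqrt) simp
    then have "0 \<le> (x - 3) * (x + 2)" by simp
    then have "x + 6 \<le> real d" unfolding x2[symmetric] by (simp add: algebra_simps power2_eq_square)
    then show ?thesis using s(2) m(1) n_def by linarith
  next
    case False
    then have "x \<le> 3" unfolding x_def by (intro real_le_lsqrt) auto
    then have "s \<le> 2" using s(2) by linarith
    then show ?thesis using assms(1) unfolding m_def n_def by linarith
  qed
  interpret cs_polygon_weight d p n m s
    by unfold_locales (use assms m m_ge s_ge n_def in auto)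
  have nm: "m + s \<le> n" "2 * m \<le> n + s" using m m_ge s_ge by linarith+
  let ?T = "caterpillar 0 word_A" and ?T' = "caterpillar m word_B"
  let ?c = "5 * real d / 2 - 4 * sqrt (real d) - 4"
  have flips: "?c \<le> real k" if k: "(flip d p ^^ k) ?T ?T'" for k
  proof -
    have "real_of_int ((s + n - 2 * m) * (2 * N) + (m - s - 2) * (6 * N - 2) + 3 + (2 * s - 1) * N
      + (s - 1) * (N + 3) + (n - m - s) * (4 * N - 2)) \<le> real_of_int (2 * N * int k)"
      using flips_ge[OF m_ge nm(1) m(1) nm(2) k] by (simp only: of_int_le_iff)
    then have "5 * x\<^sup>2 / 2 - 4 * x - 4 \<le> real k"
      using x s m x2 by (intro final_estimate[of x "real_of_int N" "real_of_int s" "real_of_int n" "real_of_int m"])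
        (simp_all add: N_def n_def)
    then show ?thesis by (simp add: x2 x_def)
  qed
  have "enat (nat \<lceil>?c\<rceil>) \<le> flip_distance d p ?T ?T'"
    unfolding flip_distance_def using flips
    by (intro INF_greatest) (simp only: mem_Collect_eq enat_ord_simps nat_ceiling_le_eq)
  then have "ereal_of_enat (enat (nat \<lceil>?c\<rceil>)) \<le> ereal_of_enat (flip_distance d p ?T ?T')"
    by (simp only: ereal_of_enat_le_iff)
  moreover have "ereal ?c \<le> ereal_of_enat (enat (nat \<lceil>?c\<rceil>))"
    using real_nat_ceiling_ge[of ?c] by simp
  ultimately have "ereal ?c \<le> ereal_of_enat (flip_distance d p ?T ?T')" by (rule order_trans[rotated])
  then show ?thesis
    using cs_triangulation_caterpillar length_word_A length_word_B m_ge nm m by blast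
qed

end
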